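(* Let $\hat{\mathbf Q}\in\hat{\mathbb Q}^{n\times n}$ be a dual quaternion Hermitian matrix and $\hat P=\mathcal J(\hat{\mathbf Q})$. Suppose that $\hat U$ is a unitary dual complex matrix such that $$\hat U^*\hat P\hat U=\operatorname{diag}(\hat\lambda_1\hat I_{t_1},\hat\lambda_2\hat I_{t_2},\dots,\hat\lambda_l\hat I_{t_l}).$$ Denote $\hat U=[\hat U_1,\hat U_2,\dots,\hat U_l]$, where $\hat U_i=[\hat{\mathbf u}^i_1,\hat{\mathbf u}^i_2,\dots,\hat{\mathbf u}^i_{t_i}]\in\mathbb{DC}^{2n\times t_i}$. Let $\hat{\mathbf v}^i_j=\mathcal F^{-1}(\hat{\mathbf u}^i_j)$ for $i=1,2,\dots,l$, $j=1,2,\dots,t_i$. Then applying the Dual Quaternion Eigenvectors Orthogonalization procedure to $\{\hat{\mathbf v}^i_j\}_{j=1}^{t_i}$ yields a set of orthogonal eigenvectors $\{\hat{\mathbf w}^i_j\}_{j=1}^{m_i}$ of $\hat{\mathbf Q}$ with respect to the eigenvalue $\hat\lambda_i$, and $\{\hat{\mathbf w}^i_j\}_{i,j}$ is a complete eigenvector set of $\hat{\mathbf Q}$.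
   Context: $\varepsilon$ is the infinitesimal unit: $\varepsilon\ne0$, $\varepsilon^2=0$, commuting with complex numbers and quaternions. $\mathbb D$, $\mathbb{DC}$, $\hat{\mathbb Q}$ are the dual numbers, dual complex numbers and dual quaternions, i.e. elements $a_{st}+a_{\mathcal I}\varepsilon$ with $a_{st},a_{\mathcal I}$ in $\mathbb R$, $\mathbb C$, and the real quaternions $\mathbb Q$ (units $\mathbf i,\mathbf j,\mathbf k$), respectively; $\mathbb C=\mathbb R+\mathbb R\mathbf i\subset\mathbb Q$. $a_{st}$ is the standard part; a vector is appreciable if its standard part is nonzero. $\hat I_t$ is the $t\times t$ identity matrix. $^*$ is the conjugate transpose; $\hat{\mathbf Q}$ is Hermitian if $\hat{\mathbf Q}^*=\hat{\mathbf Q}$; a square dual complex matrix $\hat U$ is unitary if $\hat U^*\hat U=\hat U\hat U^*=\hat I$. Vectors $\hat{\mathbf x},\hat{\mathbf y}$ are orthogonal if $\hat{\mathbf x}^*\hat{\mathbf y}=\hat0$. A dual number $\hat\lambda$ is an eigenvalue of $\hat{\mathbf Q}$ with eigenvector $\hat{\mathbf x}\in\hat{\mathbb Q}^{n\times1}$ if $\hat{\mathbf x}$ is appreciable and $\hat{\mathbf Q}\hat{\mathbf x}=\hat{\mathbf x}\hat\lambda$; a dual quaternion Hermitian matrix of dimension $n$ has exactly $n$ eigenvalues (counted with multiplicity), all of which are dual numbers. A complete eigenvector set of $\hat{\mathbf Q}$ is a set of eigenvectors accounting for all $n$ of these eigenvalues, counted with multiplicity. Every $\hat{\mathbf Q}\in\hat{\mathbb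 Q}^{m\times n}$ is uniquely $(A_1+A_2\mathbf j)+(A_3+A_4\mathbf j)\varepsilon$ with $A_1,A_2,A_3,A_4\in\mathbb C^{m\times n}$, and its dual complex adjoint matrix is $$\mathcal J(\hat{\mathbf Q})=\begin{bmatrix}A_1&A_2\\-\overline{A_2}&\overline{A_1}\end{bmatrix}+\begin{bmatrix}A_3&A_4\\-\overline{A_4}&\overline{A_3}\end{bmatrix}\varepsilon .$$ The bijection $\mathcal F:\hat{\mathbb Q}^{n\times1}\to\mathbb{DC}^{2n\times1}$ has inverse, for $\mathbf u_1,\mathbf u_2,\mathbf u_3,\mathbf u_4\in\mathbb C^{n\times1}$, $$\mathcal F^{-1}\left(\begin{bmatrix}\mathbf u_1\\\mathbf u_2\end{bmatrix}+\begin{bmatrix}\mathbf u_3\\\mathbf u_4\end{bmatrix}\varepsilon\right)=\mathbf u_1-\overline{\mathbf u_2}\,\mathbf j+(\mathbf u_3-\overline{\mathbf u_4}\,\mathbf j)\varepsilon .$$ The 2-norm of $\hat{\mathbf x}=\tilde{\mathbf x}_{st}+\tilde{\mathbf x}_{\mathcal I}\varepsilon\in\hat{\mathbb Q}^{n\times1}$ is the dual number $\|\hat{\mathbf x}\|_2=\sqrt{\hat{\mathbf x}^*\hat{\mathbf x}}$ if $\tilde{\mathbf x}_{st}\ne0$ (with $\sqrt{a+b\varepsilon}=\sqrt a+\frac{b}{2\sqrt a}\varepsilon$ for $a>0$), and $\|\tilde{\mathbf x}_{\mathcal I}\|\varepsilon$ if $\tilde{\mathbf x}_{st}=0$, where $\|\tilde{\mathbf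 x}\|=\sqrt{\sum_i|\tilde x_i|^2}$ for a quaternion vector. Dual Quaternion Eigenvectors Orthogonalization procedure. Input: a set $\{\hat{\mathbf v}_i\}_{i=1}^m$ of eigenvectors of a dual quaternion Hermitian matrix with respect to an eigenvalue $\hat\lambda$. Set $t=1$, $\hat{\mathbf u}_1=\hat{\mathbf v}_1/\|\hat{\mathbf v}_1\|_2$. For $j=2,\dots,m$: compute $\hat{\mathbf w}=\hat{\mathbf v}_j-\sum_{i=1}^t\hat{\mathbf u}_i\hat{\mathbf u}_i^*\hat{\mathbf v}_j$ and write $\|\hat{\mathbf w}\|_2=w_1+w_2\varepsilon$; if $w_1>0$, increase $t$ by $1$ and set $\hat{\mathbf u}_t=\hat{\mathbf w}/\|\hat{\mathbf w}\|_2$ (with the new $t$). Output: $\{\hat{\mathbf u}_k\}_{k=1}^t$. For the input $\{\hat{\mathbf v}^i_j\}_{j=1}^{t_i}$ the output is denoted $\{\hat{\mathbf w}^i_j\}_{j=1}^{m_i}$, so $m_i$ is the number of vectors output.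
   Formalization: The dual numbers λ_1,…,λ_l are taken pairwise distinct; otherwise the claim fails (n=1, Q=λ, U=I_2, l=2, t_1=t_2=1, λ_1=λ_2=λ gives two output vectors 1 and −j for a single eigenvalue). *)

theory Defs
  imports Complex_Main "HOL-Library.Multiset" "Jordan_Normal_Form.Matrix"
begin

section \<open>Rings with involution\<close>

class star_ring = ring_1 +
  fixes star :: "'a \<Rightarrow> 'a"
  assumes star_add: "star (x + y) = star x + star y"
    and star_mult: "star (x * y) = star y * star x"
    and star_star [simp]: "star (star x) = x"

lemma star_zero [simp]: "star (0::'a::star_ring) = 0"
  using star_add[of "0::'a" 0] by simp

lemma star_one [simp]: "star (1::'a::star_ring) = 1"
  by (metis mult.left_neutral mult.right_neutral star_mult star_star)

lemma star_sum: "star (sum f A) = (\<Sum>x\<in>A. star (f x :: 'a::star_ring))"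
  by (induction A rule: infinite_finite_induct) (auto simp: star_add)

instantiation complex :: star_ring
begin
definition "star (z::complex) = cnj z"
instance by standard (simp_all add: star_complex_def)
end


section \<open>Quaternions\<close>

datatype quat = Quat (qre: real) (qi: real) (qj: real) (qk: real)

instantiation quat :: ring_1
begin
definition "0 = Quat 0 0 0 0"
definition "1 = Quat 1 0 0 0"
definition "p + q = Quat (qre p + qre q) (qi p + qi q) (qj p + qj q) (qk p + qk q)"
definition "p - q = Quat (qre p - qre q) (qi p - qi q) (qj p - qj q) (qk p - qk q)"
definition "- q = Quat (- qre q) (- qi q) (- qj q) (- qk q)"
definition "p * q = Quat
  (qre p * qre q - qi p * qi q - qj p * qj q - qk p * qk q)
  (qre p * qi q + qi p * qre q + qj p * qk q - qk p * qj q)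
  (qre p * qj q - qi p * qk q + qj p * qre q + qk p * qi q)
  (qre p * qk q + qi p * qj q - qj p * qi q + qk p * qre q)"
instance
  by standard
    (simp_all add: zero_quat_def one_quat_def plus_quat_def minus_quat_def uminus_quat_def
      times_quat_def algebra_simps)
end

lemma quat_sel [simp]:
  "qre 0 = 0" "qi 0 = 0" "qj 0 = 0" "qk 0 = 0"
  "qre 1 = 1" "qi 1 = 0" "qj 1 = 0" "qk 1 = 0"
  "qre (p + q) = qre p + qre q" "qi (p + q) = qi p + qi q"
  "qj (p + q) = qj p + qj q" "qk (p + q) = qk p + qk q"
  "qre (p - q) = qre p - qre q" "qi (p - q) = qi p - qi q"
  "qj (p - q) = qj p - qj q" "qk (p - q) = qk p - qk q"
  "qre (- p) = - qre p" "qi (- p) = - qi p" "qj (- p) = - qj p" "qk (- p) = - qk p"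
  "qre (p * q) = qre p * qre q - qi p * qi q - qj p * qj q - qk p * qk q"
  "qi (p * q) = qre p * qi q + qi p * qre q + qj p * qk q - qk p * qj q"
  "qj (p * q) = qre p * qj q - qi p * qk q + qj p * qre q + qk p * qi q"
  "qk (p * q) = qre p * qk q + qi p * qj q - qj p * qi q + qk p * qre q"
  by (simp_all add: zero_quat_def one_quat_def plus_quat_def minus_quat_def uminus_quat_def
      times_quat_def)

instantiation quat :: real_algebra_1
begin
definition "scaleR r q = Quat (r * qre q) (r * qi q) (r * qj q) (r * qk q)"
instance
  by standard (simp_all add: scaleR_quat_def quat.expand algebra_simps)
end

lemma quat_sel_scaleR [simp]:
  "qre (r *\<^sub>R q) = r * qre q" "qi (r *\<^sub>R q) = r * qi q"
  "qj (r *\<^sub>R q) = r * qj q" "qk (r *\<^sub>R q) = r * qk q"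
  by (simp_all add: scaleR_quat_def)

instantiation quat :: star_ring
begin
definition "star q = Quat (qre q) (- qi q) (- qj q) (- qk q)"
instance by standard (simp_all add: star_quat_def quat.expand)
end

lemma quat_sel_star [simp]:
  "qre (star q) = qre q" "qi (star q) = - qi q" "qj (star q) = - qj q" "qk (star q) = - qk q"
  by (simp_all add: star_quat_def)

definition quat_abs :: "quat \<Rightarrow> real" where
  "quat_abs q = sqrt ((qre q)\<^sup>2 + (qi q)\<^sup>2 + (qj q)\<^sup>2 + (qk q)\<^sup>2)"

definition quat_j :: quat where
  "quat_j = Quat 0 0 1 0"

definition quat_of_complex :: "complex \<Rightarrow> quat" where
  "quat_of_complex z = Quat (Re z) (Im z) 0 0"

text \<open>The components \<open>a\<close>, \<open>b\<close> of the unique decomposition \<open>q = a + b j\<close> with \<open>a\<close>, \<open>b\<close> complex.\<close>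

definition cpart1 :: "quat \<Rightarrow> complex" where
  "cpart1 q = Complex (qre q) (qi q)"

definition cpart2 :: "quat \<Rightarrow> complex" where
  "cpart2 q = Complex (qj q) (qk q)"

lemma quat_eq_cparts_iff:
  "q = quat_of_complex a + quat_of_complex b * quat_j \<longleftrightarrow> a = cpart1 q \<and> b = cpart2 q"
  by (auto simp: quat_of_complex_def quat_j_def cpart1_def cpart2_def quat.expand complex_eq_iff)


section \<open>Dual numbers over a ring\<close>

datatype 'a dual = Dual (std_part: 'a) (inf_part: 'a)

instantiation dual :: (ring_1) ring_1
begin
definition "0 = Dual 0 0"
definition "1 = Dual 1 0"
definition "a + b = Dual (std_part a + std_part b) (inf_part a + inf_part b)"
definition "a - b = Dual (std_part a - std_part b) (inf_part a - inf_part b)"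
definition "- a = Dual (- std_part a) (- inf_part a)"
definition "a * b =
  Dual (std_part a * std_part b) (std_part a * inf_part b + inf_part a * std_part b)"
instance
  by standard
    (simp_all add: zero_dual_def one_dual_def plus_dual_def minus_dual_def uminus_dual_def
      times_dual_def algebra_simps)
end

instance dual :: (comm_ring_1) comm_ring_1
  by standard (simp_all add: times_dual_def plus_dual_def one_dual_def algebra_simps)

lemma dual_sel [simp]:
  "std_part 0 = 0" "inf_part 0 = 0" "std_part 1 = 1" "inf_part 1 = 0"
  "std_part (a + b) = std_part a + std_part b" "inf_part (a + b) = inf_part a + inf_part b"
  "std_part (a - b) = std_part a - std_part b" "inf_part (a - b) = inf_part a - inf_part b"
  "std_part (- a) = - std_part a" "inf_part (- a) = - inf_part a"
  "std_part (a * b) = std_part a * std_part b"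
  "inf_part (a * b) = std_part a * inf_part b + inf_part a * std_part b"
  by (simp_all add: zero_dual_def one_dual_def plus_dual_def minus_dual_def uminus_dual_def
      times_dual_def)

instantiation dual :: (star_ring) star_ring
begin
definition "star a = Dual (star (std_part a)) (star (inf_part a))"
instance by standard (simp_all add: star_dual_def dual.expand star_add star_mult add.commute)
end

lemma dual_sel_star [simp]:
  "std_part (star a) = star (std_part a)" "inf_part (star a) = star (inf_part a)"
  by (simp_all add: star_dual_def)

definition of_dual :: "real dual \<Rightarrow> 'a::real_algebra_1 dual" where
  "of_dual = map_dual of_real"

lemma dual_sel_of_dual [simp]:
  "std_part (of_dual a) = of_real (std_part a)" "inf_part (of_dual a) = of_real (inf_part a)"
  by (simp_all add: of_dual_def dual.map_sel)

text \<open>Only meaningful if the standard part is nonzero, respectively positive.\<close>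

definition dual_inverse :: "real dual \<Rightarrow> real dual" where
  "dual_inverse a = Dual (1 / std_part a) (- inf_part a / (std_part a)\<^sup>2)"

definition dual_sqrt :: "real dual \<Rightarrow> real dual" where
  "dual_sqrt a = Dual (sqrt (std_part a)) (inf_part a / (2 * sqrt (std_part a)))"

lemma dual_inverse: "std_part a \<noteq> 0 \<Longrightarrow> a * dual_inverse a = 1"
  by (simp add: dual.expand dual_inverse_def power2_eq_square field_simps)


section \<open>Matrices and vectors over rings with involution\<close>

definition ctranspose :: "'a::star_ring mat \<Rightarrow> 'a mat" where
  "ctranspose A = map_mat star (transpose_mat A)"

definition hermitian :: "'a::star_ring mat \<Rightarrow> bool" where
  "hermitian A \<longleftrightarrow> ctranspose A = A"

definition unitary :: "nat \<Rightarrow> 'a::star_ring mat \<Rightarrow> bool" where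
  "unitary n U \<longleftrightarrow> U \<in> carrier_mat n n \<and> ctranspose U * U = 1\<^sub>m n \<and> U * ctranspose U = 1\<^sub>m n"

definition cinner :: "'a::star_ring vec \<Rightarrow> 'a vec \<Rightarrow> 'a" where
  "cinner x y = map_vec star x \<bullet> y"

text \<open>Scalars act on column vectors from the right, whereas \<open>\<cdot>\<^sub>v\<close> multiplies from the left.\<close>

definition rsmult_vec :: "'a::times vec \<Rightarrow> 'a \<Rightarrow> 'a vec" (infixl \<open>\<cdot>\<^sub>r\<close> 70) where
  "x \<cdot>\<^sub>r a = map_vec (\<lambda>y. y * a) x"

definition appreciable :: "'a::zero dual vec \<Rightarrow> bool" where
  "appreciable x \<longleftrightarrow> map_vec std_part x \<noteq> 0\<^sub>v (dim_vec x)"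

definition rlin_independent :: "nat \<Rightarrow> 'a::semiring_0 vec set \<Rightarrow> bool" where
  "rlin_independent n X \<longleftrightarrow>
    (\<forall>c. (\<forall>k<n. (\<Sum>x\<in>X. x $ k * c x) = 0) \<longrightarrow> (\<forall>x\<in>X. c x = 0))"


section \<open>Eigenvectors and eigenvalues of dual quaternion matrices\<close>

definition dq_eigenvector :: "quat dual mat \<Rightarrow> quat dual vec \<Rightarrow> real dual \<Rightarrow> bool" where
  "dq_eigenvector Q x a \<longleftrightarrow>
    x \<in> carrier_vec (dim_row Q) \<and> appreciable x \<and> Q *\<^sub>v x = x \<cdot>\<^sub>r of_dual a"

text \<open>The eigenvalues of a Hermitian matrix, counted with multiplicity, are the diagonal entries of
  a unitary diagonalization. They do not depend on the diagonalization, see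
  \<open>dq_eigenvalues_unique\<close> below.\<close>

definition dq_eigenvalues :: "quat dual mat \<Rightarrow> real dual multiset \<Rightarrow> bool" where
  "dq_eigenvalues Q M \<longleftrightarrow>
    (\<exists>V \<mu>. unitary (dim_row Q) V \<and>
      ctranspose V * Q * V = mat_diag (dim_row Q) (\<lambda>k. of_dual (\<mu> k)) \<and>
      M = image_mset \<mu> (mset_set {..<dim_row Q}))"

text \<open>Accounting for the multiplicities requires independence: for a double eigenvalue \<open>a\<close> with
  eigenvector \<open>x\<close>, the set \<open>{x, x \<cdot>\<^sub>r i}\<close> consists of two eigenvectors for \<open>a\<close>, but accounts for
  \<open>a\<close> only once.\<close>

definition complete_eigenvector_set :: "quat dual mat \<Rightarrow> quat dual vec set \<Rightarrow> bool" where
  "complete_eigenvector_set Q X \<longleftrightarrow>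
    finite X \<and> rlin_independent (dim_row Q) X \<and>
    (\<exists>\<mu>. (\<forall>x\<in>X. dq_eigenvector Q x (\<mu> x)) \<and> dq_eigenvalues Q (image_mset \<mu> (mset_set X)))"


section \<open>Dual complex adjoint matrix\<close>

text \<open>With \<open>A = A\<^sub>1 + A\<^sub>3 \<epsilon>\<close> and \<open>B = A\<^sub>2 + A\<^sub>4 \<epsilon>\<close> one has \<open>Q = A + B j\<close>.\<close>

definition dc_adjoint :: "quat dual mat \<Rightarrow> complex dual mat" where
  "dc_adjoint Q =
    (let A = map_mat (map_dual cpart1) Q; B = map_mat (map_dual cpart2) Q
     in four_block_mat A B (- map_mat star B) (map_mat star A))"

definition F_inv :: "nat \<Rightarrow> complex dual vec \<Rightarrow> quat dual vec" where
  "F_inv n u = vec n (\<lambda>i. map_dual quat_of_complex (u $ i)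
     - map_dual quat_of_complex (star (u $ (n + i))) * Dual quat_j 0)"


section \<open>Orthogonalization\<close>

definition quat_vec_norm :: "quat vec \<Rightarrow> real" where
  "quat_vec_norm x = sqrt (\<Sum>i<dim_vec x. (quat_abs (x $ i))\<^sup>2)"

text \<open>The dual quaternion \<open>x\<^sup>* x\<close> is a dual number; \<open>map_dual qre\<close> only changes its type.\<close>

lemma cinner_self_dual: "of_dual (map_dual qre (cinner x x)) = cinner x x"
proof -
  have real: "of_real (qre q) = q" if "star q = q" for q :: quat
  proof (rule quat.expand)
    show "qre (of_real (qre q)) = qre q \<and> qi (of_real (qre q)) = qi q \<and>
        qj (of_real (qre q)) = qj q \<and> qk (of_real (qre q)) = qk q"
      using arg_cong[OF that, of qi] arg_cong[OF that, of qj] arg_cong[OF that, of qk]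
      by (simp add: of_real_def)
  qed
  have "star (cinner x x) = cinner x x"
    by (simp add: cinner_def scalar_prod_def star_sum star_mult)
  then have "star (std_part (cinner x x)) = std_part (cinner x x)"
    "star (inf_part (cinner x x)) = inf_part (cinner x x)"
    by (metis dual_sel_star)+
  then show ?thesis
    by (intro dual.expand) (simp add: real dual.map_sel)
qed

definition dq_norm2 :: "quat dual vec \<Rightarrow> real dual" where
  "dq_norm2 x =
    (if appreciable x then dual_sqrt (map_dual qre (cinner x x))
     else Dual 0 (quat_vec_norm (map_vec inf_part x)))"

definition dq_normalize :: "quat dual vec \<Rightarrow> quat dual vec" where
  "dq_normalize x = x \<cdot>\<^sub>r of_dual (dual_inverse (dq_norm2 x))"

definition dq_residual :: "quat dual vec list \<Rightarrow> quat dual vec \<Rightarrow> quat dual vec" where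
  "dq_residual us v = vec (dim_vec v) (\<lambda>k. v $ k - (\<Sum>u\<leftarrow>us. (u \<cdot>\<^sub>r cinner u v) $ k))"

fun dq_orth_loop :: "quat dual vec list \<Rightarrow> quat dual vec list \<Rightarrow> quat dual vec list" where
  "dq_orth_loop us [] = us"
| "dq_orth_loop us (v # vs) =
    (let w = dq_residual us v
     in if std_part (dq_norm2 w) > 0 then dq_orth_loop (us @ [dq_normalize w]) vs
        else dq_orth_loop us vs)"

fun dq_orthogonalize :: "quat dual vec list \<Rightarrow> quat dual vec list" where
  "dq_orthogonalize [] = []"
| "dq_orthogonalize (v # vs) = dq_orth_loop [dq_normalize v] vs"


section \<open>Uniqueness of the eigenvalues\<close>

lemma ctranspose_carrier [simp]: "A \<in> carrier_mat n m \<Longrightarrow> ctranspose A \<in> carrier_mat m n"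
  by (simp add: ctranspose_def)

lemma ctranspose_mult:
  fixes A B :: "'a::star_ring mat"
  assumes "A \<in> carrier_mat n m" "B \<in> carrier_mat m k"
  shows "ctranspose (A * B) = ctranspose B * ctranspose A"
  using assms
  by (intro eq_matI) (auto simp: ctranspose_def scalar_prod_def star_sum star_mult intro!: sum.cong)

lemma ctranspose_ctranspose: "ctranspose (ctranspose (A :: 'a::star_ring mat)) = A"
  by (rule eq_matI) (auto simp: ctranspose_def)

lemma qre_sum: "qre (sum f A) = (\<Sum>x\<in>A. qre (f x))"
  by (induction A rule: infinite_finite_induct) auto

lemma std_part_sum: "std_part (sum f A) = (\<Sum>x\<in>A. std_part (f x :: 'a::ring_1 dual))"
  by (induction A rule: infinite_finite_induct) auto

lemma unitary_row_col_sum: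
  fixes S :: "quat dual mat"
  assumes "unitary n S" "i < n"
  defines "q \<equiv> \<lambda>i j. (quat_abs (std_part (S $$ (i, j))))\<^sup>2"
  shows "(\<Sum>j<n. q i j) = 1" "(\<Sum>j<n. q j i) = 1"
proof -
  have S: "S \<in> carrier_mat n n" and *: "ctranspose S * S = 1\<^sub>m n" "S * ctranspose S = 1\<^sub>m n"
    using assms(1) by (auto simp: unitary_def)
  have q: "qre (p * star p) = (quat_abs p)\<^sup>2" "qre (star p * p) = (quat_abs p)\<^sup>2" for p
    by (simp_all add: quat_abs_def power2_eq_square)
  have "(S * ctranspose S) $$ (i, i) = 1" "(ctranspose S * S) $$ (i, i) = 1"
    using * \<open>i < n\<close> by auto
  then have "qre (std_part ((S * ctranspose S) $$ (i, i))) = 1"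
    "qre (std_part ((ctranspose S * S) $$ (i, i))) = 1"
    by auto
  then show "(\<Sum>j<n. q i j) = 1" "(\<Sum>j<n. q j i) = 1"
    using S \<open>i < n\<close>
    by (simp_all add: ctranspose_def scalar_prod_def std_part_sum qre_sum q q_def atLeast0LessThan
        del: quat_sel(21))
qed

theorem dq_eigenvalues_unique:
  assumes "Q \<in> carrier_mat n n" "dq_eigenvalues Q M" "dq_eigenvalues Q N"
  shows "M = N"
proof -
  have dim: "dim_row Q = n" and Q: "Q \<in> carrier_mat n n"
    using assms(1) by auto
  from assms(2) obtain V \<mu> where uV: "unitary n V"
    and DV: "ctranspose V * Q * V = mat_diag n (\<lambda>k. of_dual (\<mu> k))"
    and M: "M = image_mset \<mu> (mset_set {..<n})"
    unfolding dq_eigenvalues_def dim by blast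
  from assms(3) obtain W \<nu> where uW: "unitary n W"
    and DW: "ctranspose W * Q * W = mat_diag n (\<lambda>k. of_dual (\<nu> k))"
    and N: "N = image_mset \<nu> (mset_set {..<n})"
    unfolding dq_eigenvalues_def dim by blast
  have V: "V \<in> carrier_mat n n" "ctranspose V \<in> carrier_mat n n"
    and W: "W \<in> carrier_mat n n" "ctranspose W \<in> carrier_mat n n"
    and VV: "ctranspose V * V = 1\<^sub>m n" "V * ctranspose V = 1\<^sub>m n"
    and WW: "ctranspose W * W = 1\<^sub>m n" "W * ctranspose W = 1\<^sub>m n"
    using uV uW by (auto simp: unitary_def)
  define S where "S = ctranspose V * W"
  have S: "S \<in> carrier_mat n n"
    unfolding S_def by (rule mult_carrier_mat[OF V(2) W(1)])
  have cS: "ctranspose S = ctranspose W * V"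
    unfolding S_def using ctranspose_mult[OF V(2) W(1)] by (simp add: ctranspose_ctranspose)
  note am = assoc_mult_mat[where ?n\<^sub>1.0 = n and ?n\<^sub>2.0 = n and ?n\<^sub>3.0 = n and ?n\<^sub>4.0 = n]
  have mc: "A * B \<in> carrier_mat n n" if "A \<in> carrier_mat n n" "B \<in> carrier_mat n n"
    for A B :: "quat dual mat" using that by simp
  have VW: "V * (ctranspose V * X) = X" "W * (ctranspose W * X) = X"
    "ctranspose V * (V * X) = X" "ctranspose W * (W * X) = X"
    if "X \<in> carrier_mat n n" for X
    using am[OF V(1) V(2) that] am[OF W(1) W(2) that] am[OF V(2) V(1) that] am[OF W(2) W(1) that]
      VV WW that by auto
  have uS: "unitary n S"
    unfolding unitary_def cS unfolding S_def
    using V W by (auto simp: am mc VW VV WW)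
  have eq: "mat_diag n (\<lambda>k. of_dual (\<mu> k)) * S = S * mat_diag n (\<lambda>k. of_dual (\<nu> k))"
    unfolding DV[symmetric] DW[symmetric] S_def
    using V W Q by (simp add: am mc VW)
  have ent: "of_dual (\<mu> i) * S $$ (i, j) = S $$ (i, j) * of_dual (\<nu> j)" if "i < n" "j < n" for i j
    using arg_cong[OF eq, of "\<lambda>X. X $$ (i, j)"] that S
    by (simp add: mat_diag_mult_left[OF S] mat_diag_mult_right[OF S])
  define q where "q = (\<lambda>i j. (quat_abs (std_part (S $$ (i, j))))\<^sup>2)"
  have q0: "q i j = 0" if "i < n" "j < n" "\<mu> i \<noteq> \<nu> j" for i j
  proof (rule ccontr)
    assume "q i j \<noteq> 0"
    then have nz: "std_part (S $$ (i, j)) \<noteq> 0"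
      by (auto simp: q_def quat_abs_def)
    have comm: "p * of_real r = r *\<^sub>R p" "of_real r * p = r *\<^sub>R p" for p :: quat and r
      by (simp_all add: of_real_def)
    have "std_part (\<mu> i) *\<^sub>R std_part (S $$ (i, j)) = std_part (\<nu> j) *\<^sub>R std_part (S $$ (i, j))"
      using arg_cong[OF ent[OF that(1,2)], of std_part] by (simp add: comm)
    then have s: "std_part (\<mu> i) = std_part (\<nu> j)"
      using nz by (auto simp: quat.expand)
    have "inf_part (\<mu> i) *\<^sub>R std_part (S $$ (i, j)) = inf_part (\<nu> j) *\<^sub>R std_part (S $$ (i, j))"
      using arg_cong[OF ent[OF that(1,2)], of inf_part] by (simp add: comm s)
    then have "inf_part (\<mu> i) = inf_part (\<nu> j)"
      using nz by (auto simp: quat.expand)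
    with s that(3) show False by (simp add: dual.expand)
  qed
  have "count M a = count N a" for a
  proof -
    define R where "R = {i\<in>{..<n}. \<mu> i = a}"
    define C where "C = {j\<in>{..<n}. \<nu> j = a}"
    have "real (card R) = (\<Sum>i\<in>R. \<Sum>j<n. q i j)"
      using unitary_row_col_sum(1)[OF uS] by (simp add: q_def R_def)
    also have "\<dots> = (\<Sum>i\<in>R. \<Sum>j\<in>C. q i j)"
      by (intro sum.cong[OF refl] sum.mono_neutral_right) (auto simp: R_def C_def intro!: q0)
    also have "\<dots> = (\<Sum>j\<in>C. \<Sum>i\<in>R. q i j)"
      by (rule sum.swap)
    also have "\<dots> = (\<Sum>j\<in>C. \<Sum>i<n. q i j)"
      by (intro sum.cong[OF refl] sum.mono_neutral_left) (auto simp: R_def C_def intro!: q0)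
    also have "\<dots> = real (card C)"
      using unitary_row_col_sum(2)[OF uS] by (simp add: q_def C_def)
    finally have "card R = card C" by simp
    moreover have "count (image_mset f (mset_set {..<n})) a = card {i\<in>{..<n}. f i = a}"
      for f :: "nat \<Rightarrow> real dual"
    proof -
      have "f -` {a} \<inter> {..<n} = {i\<in>{..<n}. f i = a}" by blast
      then show ?thesis by (simp add: count_image_mset)
    qed
    ultimately show ?thesis by (simp add: M N R_def C_def)
  qed
  then show ?thesis by (rule multiset_eqI)
qed

end

theory Submission
  imports Defs
begin

text \<open>
  The theorem has three ingredients.

  \<^item> The map \<open>\<F>\<^sup>-\<^sup>1\<close> is linear for complex scalars acting on the right and turns the adjoint matrix
  into \<open>Q\<close> itself (\<open>F_inv_dc_adjoint\<close>). Hence the columns of \<open>U\<close>, which are eigenvectors of the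
  adjoint matrix, become eigenvectors of \<open>Q\<close>. Because the columns of \<open>U\<close> span the whole dual
  complex space, the vectors \<open>v i j\<close> span the whole dual quaternion space
  (\<open>unit_vec_F_inv_combination\<close>).

  \<^item> Orthogonalizing eigenvectors for one eigenvalue yields orthonormal eigenvectors for this
  eigenvalue. A vector is discarded exactly if its residual is infinitesimal, so on the level of
  standard parts nothing is lost from the span (\<open>dq_orthogonalize_correct\<close>).

  \<^item> Eigenvectors for distinct eigenvalues have orthogonal standard parts, even if the eigenvalues
  differ only in their infinitesimal parts (\<open>eigenvectors_std_orthogonal\<close>). Hence the standard parts
  of all output vectors together are an orthonormal spanning set of the quaternion space, and so there
  are exactly \<open>n\<close> of them (\<open>std_basis_card\<close>).

  It remains to see that these \<open>n\<close> eigenvectors carry the right multiplicities. This is not immediate: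
  output vectors for eigenvalues with the same standard part need not be orthogonal to each other, their
  inner product may be an infinitesimal. The matrix \<open>W\<close> with these columns is therefore not
  unitary in general, but only \<open>W\<^sup>* W = I + 2 K\<close> with an infinitesimal Hermitian \<open>K\<close>.
  Since \<open>K\<^sup>2 = 0\<close>, the matrix \<open>W (I - K)\<close> is unitary. An entry of \<open>K\<close> can be nonzero only where
  the two eigenvalues have the same standard part, and the infinitesimal parts of the eigenvalues are
  annihilated by \<open>K\<close>, so \<open>K\<close> commutes with the diagonal matrix of eigenvalues and \<open>W (I - K)\<close> still
  diagonalizes \<open>Q\<close> (\<open>infinitesimal_correction\<close>, \<open>std_eigenbasis_complete\<close>).
\<close>

section \<open>Inner products and eigenvectors in coordinates\<close>

lemma cinner_sum:
  assumes "x \<in> carrier_vec n" "y \<in> carrier_vec n"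
  shows "cinner x y = (\<Sum>k<n. star (x $ k) * y $ k)"
  using assms by (auto simp: cinner_def scalar_prod_def atLeast0LessThan intro!: sum.cong)

lemma appreciable_iff:
  assumes "x \<in> carrier_vec n"
  shows "appreciable x \<longleftrightarrow> (\<exists>k<n. std_part (x $ k) \<noteq> 0)"
  using assms by (auto simp: appreciable_def vec_eq_iff)

lemma dq_eigenvector_iff:
  assumes "Q \<in> carrier_mat n n"
  shows "dq_eigenvector Q x a \<longleftrightarrow> x \<in> carrier_vec n \<and> (\<exists>k<n. std_part (x $ k) \<noteq> 0) \<and>
    (\<forall>i<n. (\<Sum>k<n. Q $$ (i, k) * x $ k) = x $ i * of_dual a)"
proof -
  have "Q *\<^sub>v x = x \<cdot>\<^sub>r of_dual a \<longleftrightarrow> (\<forall>i<n. (\<Sum>k<n. Q $$ (i, k) * x $ k) = x $ i * of_dual a)"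
    if "x \<in> carrier_vec n"
    using assms that by (auto simp: vec_eq_iff rsmult_vec_def scalar_prod_def atLeast0LessThan)
  then show ?thesis
    using assms appreciable_iff[of x n] by (auto simp: dq_eigenvector_def)
qed

lemma dq_eigenvector_carrier:
  "Q \<in> carrier_mat n n \<Longrightarrow> dq_eigenvector Q x a \<Longrightarrow> x \<in> carrier_vec n"
  by (simp add: dq_eigenvector_def)

lemma dq_eigenvector_entry:
  "Q \<in> carrier_mat n n \<Longrightarrow> dq_eigenvector Q x a \<Longrightarrow> i < n \<Longrightarrow>
    (\<Sum>k<n. Q $$ (i, k) * x $ k) = x $ i * of_dual a"
  by (simp add: dq_eigenvector_iff)

lemma inf_part_sum: "inf_part (sum f A) = (\<Sum>x\<in>A. inf_part (f x :: 'a::ring_1 dual))"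
  by (induction A rule: infinite_finite_induct) auto

lemma std_part_cinner:
  fixes x y :: "'a::star_ring dual vec"
  assumes "x \<in> carrier_vec n" "y \<in> carrier_vec n"
  shows "std_part (cinner x y) = (\<Sum>k<n. star (std_part (x $ k)) * std_part (y $ k))"
  using assms by (simp add: cinner_sum std_part_sum)

lemma star_cinner: "dim_vec x = dim_vec y \<Longrightarrow> star (cinner x y) = cinner y x"
  by (simp add: cinner_def scalar_prod_def star_sum star_mult)

lemma of_real_quat_central: "of_real r * (p::quat) = p * of_real r"
  by (simp add: of_real_def)

lemma of_dual_central: "of_dual a * (q :: quat dual) = q * of_dual a"
  by (rule dual.expand) (simp add: of_real_quat_central algebra_simps)

lemma of_dual_mult: "of_dual (a * b) = (of_dual a * of_dual b :: 'a::real_algebra_1 dual)"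
  by (rule dual.expand) simp

lemma of_dual_one: "of_dual 1 = (1 :: 'a::real_algebra_1 dual)"
  by (rule dual.expand) simp

lemma star_of_dual: "star (of_dual a :: quat dual) = of_dual a"
  by (rule dual.expand) (simp add: quat.expand of_real_def)

lemma qre_star_mult_self: "qre (star p * p) = (quat_abs p)\<^sup>2"
  by (simp add: quat_abs_def power2_eq_square)

lemma qre_mult_star_self: "qre (p * star p) = (quat_abs p)\<^sup>2"
  by (simp add: quat_abs_def power2_eq_square)

lemma quat_abs_eq_0_iff: "quat_abs p = 0 \<longleftrightarrow> p = 0"
  by (auto simp: quat_abs_def quat.expand add_nonneg_eq_0_iff)

lemma qre_std_part_cinner_self:
  assumes "x \<in> carrier_vec n"
  shows "qre (std_part (cinner x x)) = (\<Sum>k<n. (quat_abs (std_part (x $ k)))\<^sup>2)"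
  unfolding std_part_cinner[OF assms assms] by (simp add: qre_sum qre_star_mult_self del: quat_sel)

lemma cinner_self_pos:
  fixes x :: "quat dual vec"
  assumes "appreciable x"
  shows "qre (std_part (cinner x x)) > 0"
proof -
  let ?n = "dim_vec x"
  have x: "x \<in> carrier_vec ?n" by simp
  obtain k where k: "k < ?n" "std_part (x $ k) \<noteq> 0"
    using assms appreciable_iff[OF x] by blast
  have "qre (std_part (cinner x x)) = (\<Sum>k<?n. (quat_abs (std_part (x $ k)))\<^sup>2)"
    by (rule qre_std_part_cinner_self[OF x])
  also have "\<dots> > 0"
    using k by (intro sum_pos2[of _ k]) (auto simp: quat_abs_eq_0_iff)
  finally show ?thesis .
qed


section \<open>Eigenvectors for distinct eigenvalues\<close>

lemma hermitian_cinner: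
  fixes Q :: "'a::star_ring mat"
  assumes Q: "Q \<in> carrier_mat n n" "hermitian Q" and x: "x \<in> carrier_vec n" "y \<in> carrier_vec n"
  shows "cinner (Q *\<^sub>v x) y = cinner x (Q *\<^sub>v y)"
proof -
  have QH: "star (Q $$ (i, k)) = Q $$ (k, i)" if "i < n" "k < n" for i k
    using arg_cong[OF Q(2)[unfolded hermitian_def], of "\<lambda>A. A $$ (k, i)"] Q(1) that
    by (simp add: ctranspose_def)
  have Qx: "(Q *\<^sub>v z) $ i = (\<Sum>k<n. Q $$ (i, k) * z $ k)" if "i < n" "z \<in> carrier_vec n" for i z
    using Q(1) that by (simp add: scalar_prod_def atLeast0LessThan)
  have "cinner (Q *\<^sub>v x) y = (\<Sum>i<n. \<Sum>k<n. star (x $ k) * Q $$ (k, i) * y $ i)"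
    using Q x by (subst cinner_sum[of _ n])
      (auto simp: Qx star_sum star_mult sum_distrib_right QH simp del: index_mult_mat_vec intro!: sum.cong)
  also have "\<dots> = (\<Sum>k<n. \<Sum>i<n. star (x $ k) * Q $$ (k, i) * y $ i)"
    by (rule sum.swap)
  also have "\<dots> = cinner x (Q *\<^sub>v y)"
    using Q x by (subst cinner_sum[of _ n])
      (auto simp: Qx sum_distrib_left mult.assoc simp del: index_mult_mat_vec intro!: sum.cong)
  finally show ?thesis .
qed

text \<open>Comparing \<open>(Q x)\<^sup>* y\<close> with \<open>x\<^sup>* (Q y)\<close>. A dual number may be a zero divisor, so the equation does
  not force the inner product to vanish if \<open>a \<noteq> b\<close>; what it does force depends on where \<open>a\<close> and \<open>b\<close>
  differ, as the two consequences below show.\<close>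

lemma eigenvectors_cinner:
  assumes Q: "Q \<in> carrier_mat n n" "hermitian Q"
    and x: "dq_eigenvector Q x a" and y: "dq_eigenvector Q y b"
  shows "of_dual (a - b) * cinner x y = 0"
proof -
  have c: "x \<in> carrier_vec n" "y \<in> carrier_vec n"
    and e: "Q *\<^sub>v x = x \<cdot>\<^sub>r of_dual a" "Q *\<^sub>v y = y \<cdot>\<^sub>r of_dual b"
    using x y Q(1) by (auto simp: dq_eigenvector_def)
  have "cinner (x \<cdot>\<^sub>r of_dual a) y = of_dual a * cinner x y"
    using c by (subst (1 2) cinner_sum[of _ n])
      (auto simp: rsmult_vec_def star_mult star_of_dual mult.assoc sum_distrib_left)
  moreover have "cinner x (y \<cdot>\<^sub>r of_dual b) = of_dual b * cinner x y"
    unfolding of_dual_central using c by (subst (1 2) cinner_sum[of _ n])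
      (auto simp: rsmult_vec_def mult.assoc sum_distrib_right)
  moreover have "of_dual (a - b) = (of_dual a - of_dual b :: quat dual)"
    by (rule dual.expand) simp
  ultimately show ?thesis
    using hermitian_cinner[OF Q c] by (simp add: e left_diff_distrib)
qed

lemma of_real_mult_quat_eq_0: "of_real r * (p::quat) = 0 \<longleftrightarrow> r = 0 \<or> p = 0"
  by (auto simp: of_real_def quat.expand)

text \<open>If the standard parts of \<open>a\<close> and \<open>b\<close> differ, then \<open>a - b\<close> is invertible. Otherwise
  \<open>a - b = d \<epsilon>\<close> with a real \<open>d \<noteq> 0\<close>, and \<open>d \<epsilon>\<close> kills only infinitesimals.\<close>

lemma eigenvectors_std_orthogonal:
  assumes "Q \<in> carrier_mat n n" "hermitian Q"
    and "dq_eigenvector Q x a" "dq_eigenvector Q y b" "a \<noteq> b"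
  shows "std_part (cinner x y) = 0"
proof -
  have "of_dual (a - b) * cinner x y = 0"
    by (rule eigenvectors_cinner) fact+
  from arg_cong[OF this, of std_part] arg_cong[OF this, of inf_part] \<open>a \<noteq> b\<close>
  show ?thesis
    by (cases "std_part a = std_part b")
      (auto simp: of_real_mult_quat_eq_0 dual.expand simp flip: of_real_diff)
qed

text \<open>Here \<open>a - b\<close> is invertible.\<close>

lemma eigenvectors_orthogonal:
  assumes "Q \<in> carrier_mat n n" "hermitian Q"
    and "dq_eigenvector Q x a" "dq_eigenvector Q y b" "std_part a \<noteq> std_part b"
  shows "cinner x y = 0"
proof -
  have "of_dual (a - b) * cinner x y = 0"
    by (rule eigenvectors_cinner) fact+
  from arg_cong[OF this, of std_part] arg_cong[OF this, of inf_part] \<open>std_part a \<noteq> std_part b\<close>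
  show ?thesis
    by (intro dual.expand) (auto simp: of_real_mult_quat_eq_0 simp flip: of_real_diff)
qed


section \<open>The span of the standard parts\<close>

text \<open>The vectors whose standard part lies in the right quaternion span of the standard parts of \<open>X\<close>.
  Infinitesimal parts are ignored because the orthogonalization retains its input only up to infinitesimals.\<close>

definition std_span :: "nat \<Rightarrow> quat dual vec set \<Rightarrow> quat dual vec set" where
  "std_span n X = {y. \<exists>c. \<forall>k<n. std_part (y $ k) = (\<Sum>x\<in>X. std_part (x $ k) * c x)}"

definition std_orthonormal :: "quat dual vec set \<Rightarrow> bool" where
  "std_orthonormal X \<longleftrightarrow> (\<forall>x\<in>X. \<forall>y\<in>X. std_part (cinner x y) = (if x = y then 1 else 0))"

lemma std_span_mono:
  assumes "X \<subseteq> Y" "finite Y"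
  shows "std_span n X \<subseteq> std_span n Y"
proof
  fix y assume "y \<in> std_span n X"
  then obtain c where c: "\<And>k. k < n \<Longrightarrow> std_part (y $ k) = (\<Sum>x\<in>X. std_part (x $ k) * c x)"
    by (auto simp: std_span_def)
  have "(\<Sum>x\<in>Y. std_part (x $ k) * (if x \<in> X then c x else 0)) = (\<Sum>x\<in>X. std_part (x $ k) * c x)" for k
    using assms by (intro sum.mono_neutral_cong_right) auto
  with c show "y \<in> std_span n Y"
    unfolding std_span_def mem_Collect_eq
    by (intro exI[of _ "\<lambda>x. if x \<in> X then c x else 0"]) simp
qed

lemma std_span_combination:
  assumes y: "\<And>c. c \<in> C \<Longrightarrow> y c \<in> std_span n X"
    and z: "\<And>k. k < n \<Longrightarrow> std_part (z $ k) = (\<Sum>c\<in>C. std_part (y c $ k) * s c)"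
  shows "z \<in> std_span n X"
proof -
  from y obtain d where
    d: "\<And>c k. c \<in> C \<Longrightarrow> k < n \<Longrightarrow> std_part (y c $ k) = (\<Sum>x\<in>X. std_part (x $ k) * d c x)"
    unfolding std_span_def mem_Collect_eq by metis
  have "std_part (z $ k) = (\<Sum>x\<in>X. std_part (x $ k) * (\<Sum>c\<in>C. d c x * s c))" if "k < n" for k
  proof -
    have "std_part (z $ k) = (\<Sum>c\<in>C. \<Sum>x\<in>X. std_part (x $ k) * (d c x * s c))"
      using that by (simp add: z d sum_distrib_right mult.assoc)
    also have "\<dots> = (\<Sum>x\<in>X. \<Sum>c\<in>C. std_part (x $ k) * (d c x * s c))"
      by (rule sum.swap)
    finally show ?thesis by (simp add: sum_distrib_left)
  qed
  then show ?thesis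
    unfolding std_span_def mem_Collect_eq by (intro exI allI impI)
qed

text \<open>The matrix of the sum of all \<open>x x\<^sup>*\<close> is the orthogonal projection onto the span of an
  orthonormal set, so it fixes every vector in the span.\<close>

lemma std_projection:
  assumes X: "finite X" "X \<subseteq> carrier_vec n" "std_orthonormal X"
    and y: "y \<in> std_span n X" and i: "i < n"
  shows "(\<Sum>k<n. (\<Sum>x\<in>X. std_part (x $ i) * star (std_part (x $ k))) * std_part (y $ k)) =
    std_part (y $ i)"
proof -
  from y obtain c where c: "\<And>k. k < n \<Longrightarrow> std_part (y $ k) = (\<Sum>x\<in>X. std_part (x $ k) * c x)"
    by (auto simp: std_span_def)
  have coeff: "(\<Sum>k<n. star (std_part (x $ k)) * std_part (y $ k)) = c x" if x: "x \<in> X" for x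
  proof -
    have "(\<Sum>k<n. star (std_part (x $ k)) * std_part (y $ k)) =
        (\<Sum>k<n. \<Sum>z\<in>X. star (std_part (x $ k)) * std_part (z $ k) * c z)"
      by (simp add: c sum_distrib_left mult.assoc)
    also have "\<dots> = (\<Sum>z\<in>X. \<Sum>k<n. star (std_part (x $ k)) * std_part (z $ k) * c z)"
      by (rule sum.swap)
    also have "\<dots> = (\<Sum>z\<in>X. std_part (cinner x z) * c z)"
    proof (intro sum.cong refl)
      fix z assume "z \<in> X"
      then have "x \<in> carrier_vec n" "z \<in> carrier_vec n" using X(2) x by auto
      then show "(\<Sum>k<n. star (std_part (x $ k)) * std_part (z $ k) * c z) =
          std_part (cinner x z) * c z"
        by (simp add: std_part_cinner sum_distrib_right)
    qed
    also have "\<dots> = (\<Sum>z\<in>X. if z = x then c z else 0)"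
      using X(3) x by (intro sum.cong refl) (auto simp: std_orthonormal_def)
    also have "\<dots> = c x" using X(1) x by simp
    finally show ?thesis .
  qed
  have "(\<Sum>k<n. (\<Sum>x\<in>X. std_part (x $ i) * star (std_part (x $ k))) * std_part (y $ k)) =
      (\<Sum>k<n. \<Sum>x\<in>X. std_part (x $ i) * (star (std_part (x $ k)) * std_part (y $ k)))"
    by (simp add: sum_distrib_right mult.assoc)
  also have "\<dots> = (\<Sum>x\<in>X. \<Sum>k<n. std_part (x $ i) * (star (std_part (x $ k)) * std_part (y $ k)))"
    by (rule sum.swap)
  also have "\<dots> = std_part (y $ i)"
    unfolding sum_distrib_left[symmetric] c[OF i] by (intro sum.cong refl) (simp add: coeff)
  finally show ?thesis .
qed

lemma std_resolution_of_identity: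
  assumes X: "finite X" "X \<subseteq> carrier_vec n" "std_orthonormal X"
    and span: "\<And>m. m < n \<Longrightarrow> unit_vec n m \<in> std_span n X" and "i < n" "m < n"
  shows "(\<Sum>x\<in>X. std_part (x $ i) * star (std_part (x $ m))) = (if i = m then 1 else 0)"
proof -
  have "(\<Sum>x\<in>X. std_part (x $ i) * star (std_part (x $ m))) = 
    (\<Sum>k<n. if k = m then (\<Sum>x\<in>X. std_part (x $ i) * star (std_part (x $ k))) else 0)"
    using \<open>m < n\<close> by simp
  also have "\<dots> = (\<Sum>k<n. (\<Sum>x\<in>X. std_part (x $ i) * star (std_part (x $ k))) *
      std_part (unit_vec n m $ k))"
    using \<open>m < n\<close> by (intro sum.cong refl) auto
  also have "\<dots> = (if i = m then 1 else 0)"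
    using std_projection[OF X span \<open>i < n\<close>] \<open>m < n\<close> \<open>i < n\<close> by simp
  finally show ?thesis .
qed

text \<open>Both sides are the trace of the projection: the diagonal entries add up to \<open>n\<close>, and each
  \<open>x x\<^sup>*\<close> contributes the squared norm of \<open>x\<close>, which is \<open>1\<close>. The trace of a product of
  quaternion matrices depends on the order of the factors, but its real part does not.\<close>

lemma std_basis_card:
  assumes X: "finite X" "X \<subseteq> carrier_vec n" "std_orthonormal X"
    and res: "\<And>i. i < n \<Longrightarrow> (\<Sum>x\<in>X. std_part (x $ i) * star (std_part (x $ i))) = 1"
  shows "card X = n"
proof -
  have "real (card X) = (\<Sum>x\<in>X. qre (std_part (cinner x x)))"
    using X(3) by (simp add: std_orthonormal_def)
  also have "\<dots> = (\<Sum>x\<in>X. \<Sum>k<n. (quat_abs (std_part (x $ k)))\<^sup>2)"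
    using X(2) by (intro sum.cong refl qre_std_part_cinner_self) auto
  also have "\<dots> = (\<Sum>k<n. \<Sum>x\<in>X. (quat_abs (std_part (x $ k)))\<^sup>2)"
    by (rule sum.swap)
  also have "\<dots> = (\<Sum>k<n. qre (\<Sum>x\<in>X. std_part (x $ k) * star (std_part (x $ k))))"
    by (simp add: qre_sum qre_mult_star_self del: quat_sel)
  also have "\<dots> = real n" by (simp add: res)
  finally show ?thesis by simp
qed


section \<open>Orthogonalization\<close>

definition orthonormal :: "quat dual vec set \<Rightarrow> bool" where
  "orthonormal X \<longleftrightarrow> (\<forall>x\<in>X. \<forall>y\<in>X. cinner x y = (if x = y then 1 else 0))"

lemma cinner_residual:
  assumes u: "u \<in> carrier_vec n" and v: "v \<in> carrier_vec n" and X: "X \<subseteq> carrier_vec n"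
    and w: "w \<in> carrier_vec n" "\<And>k. k < n \<Longrightarrow> w $ k = v $ k - (\<Sum>x\<in>X. x $ k * c x)"
  shows "cinner u w = cinner u v - (\<Sum>x\<in>X. cinner u x * c x)"
proof -
  have "cinner u w = (\<Sum>k<n. star (u $ k) * v $ k) - (\<Sum>k<n. \<Sum>x\<in>X. star (u $ k) * x $ k * c x)"
    using u w by (simp add: cinner_sum right_diff_distrib sum_subtractf sum_distrib_left mult.assoc)
  also have "(\<Sum>k<n. \<Sum>x\<in>X. star (u $ k) * x $ k * c x) = (\<Sum>x\<in>X. \<Sum>k<n. star (u $ k) * x $ k * c x)"
    by (rule sum.swap)
  also have "\<dots> = (\<Sum>x\<in>X. cinner u x * c x)"
  proof (intro sum.cong refl)
    fix x assume "x \<in> X"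
    then have "x \<in> carrier_vec n" using X by auto
    then show "(\<Sum>k<n. star (u $ k) * x $ k * c x) = cinner u x * c x"
      using u by (simp add: cinner_sum sum_distrib_right)
  qed
  finally show ?thesis using u v by (simp add: cinner_sum)
qed

lemma dq_residual_carrier:
  assumes "v \<in> carrier_vec n"
  shows "dq_residual us v \<in> carrier_vec n"
  unfolding dq_residual_def carrier_vecD[OF assms] by (rule vec_carrier)

lemma dq_residual_index:
  assumes "v \<in> carrier_vec n" "set us \<subseteq> carrier_vec n" "distinct us" "k < n"
  shows "dq_residual us v $ k = v $ k - (\<Sum>u\<in>set us. u $ k * cinner u v)"
proof -
  have "(\<Sum>u\<leftarrow>us. (u \<cdot>\<^sub>r cinner u v) $ k) = (\<Sum>u\<in>set us. (u \<cdot>\<^sub>r cinner u v) $ k)"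
    using assms by (simp add: sum_list_distinct_conv_sum_set)
  also have "\<dots> = (\<Sum>u\<in>set us. u $ k * cinner u v)"
    using assms by (intro sum.cong refl) (auto simp: rsmult_vec_def subset_eq)
  finally show ?thesis
    using assms by (simp add: dq_residual_def)
qed

lemma dq_residual_orthogonal:
  assumes v: "v \<in> carrier_vec n" and us: "set us \<subseteq> carrier_vec n" "distinct us" "orthonormal (set us)"
    and u: "u \<in> set us"
  shows "cinner u (dq_residual us v) = 0"
proof -
  have "cinner u (dq_residual us v) = cinner u v - (\<Sum>x\<in>set us. cinner u x * cinner x v)"
    using u us v by (intro cinner_residual[of _ n]) (auto simp: dq_residual_index dq_residual_carrier)
  also have "(\<Sum>x\<in>set us. cinner u x * cinner x v) = (\<Sum>x\<in>set us. if x = u then cinner x v else 0)"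
    using us(3) u by (intro sum.cong refl) (auto simp: orthonormal_def)
  finally show ?thesis using u by simp
qed

lemma dq_residual_eigen_equation:
  assumes Q: "Q \<in> carrier_mat n n" and v: "dq_eigenvector Q v a"
    and us: "\<And>u. u \<in> set us \<Longrightarrow> dq_eigenvector Q u a" "distinct us" and i: "i < n"
  shows "(\<Sum>k<n. Q $$ (i, k) * dq_residual us v $ k) = dq_residual us v $ i * of_dual a"
proof -
  have c: "v \<in> carrier_vec n" "set us \<subseteq> carrier_vec n"
    using dq_eigenvector_carrier[OF Q] v us(1) by blast+
  note idx = dq_residual_index[OF c us(2)]
  have "(\<Sum>k<n. Q $$ (i, k) * dq_residual us v $ k) =
     (\<Sum>k<n. Q $$ (i, k) * v $ k) - (\<Sum>k<n. \<Sum>u\<in>set us. Q $$ (i, k) * u $ k * cinner u v)"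
    by (simp add: idx right_diff_distrib sum_subtractf sum_distrib_left mult.assoc)
  also have "(\<Sum>k<n. \<Sum>u\<in>set us. Q $$ (i, k) * u $ k * cinner u v) =
     (\<Sum>u\<in>set us. \<Sum>k<n. Q $$ (i, k) * u $ k * cinner u v)"
    by (rule sum.swap)
  also have "\<dots> = (\<Sum>u\<in>set us. u $ i * of_dual a * cinner u v)"
    using i by (intro sum.cong refl) (simp add: dq_eigenvector_entry[OF Q us(1)] flip: sum_distrib_right)
  also have "\<dots> = (\<Sum>u\<in>set us. u $ i * cinner u v) * of_dual a"
    unfolding sum_distrib_right mult.assoc of_dual_central[of a] ..
  also have "(\<Sum>k<n. Q $$ (i, k) * v $ k) = v $ i * of_dual a"
    by (rule dq_eigenvector_entry[OF Q v i])
  finally show ?thesis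
    using i by (simp add: idx left_diff_distrib)
qed

lemma std_part_dq_norm2_pos_iff: "std_part (dq_norm2 x) > 0 \<longleftrightarrow> appreciable x"
  using cinner_self_pos[of x] by (auto simp: dq_norm2_def dual_sqrt_def dual.map_sel)

lemma dual_sqrt_square: "std_part a > 0 \<Longrightarrow> dual_sqrt a * dual_sqrt a = a"
  by (rule dual.expand) (auto simp: dual_sqrt_def field_simps)

lemma dq_normalize_carrier: "x \<in> carrier_vec n \<Longrightarrow> dq_normalize x \<in> carrier_vec n"
  by (simp add: dq_normalize_def rsmult_vec_def)

lemma dq_normalize_index: "x \<in> carrier_vec n \<Longrightarrow> k < n \<Longrightarrow>
    dq_normalize x $ k = x $ k * of_dual (dual_inverse (dq_norm2 x))"
  by (simp add: dq_normalize_def rsmult_vec_def)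

lemma dq_normalize_norm:
  assumes "appreciable x"
  shows "cinner (dq_normalize x) (dq_normalize x) = 1"
proof -
  define n where "n = dim_vec x"
  have x: "x \<in> carrier_vec n" by (simp add: n_def)
  define a where "a = map_dual qre (cinner x x)"
  define s where "s = dq_norm2 x"
  define r where "r = dual_inverse s"
  have s0: "std_part s > 0"
    using assms by (simp add: s_def std_part_dq_norm2_pos_iff)
  have ss: "s * s = a"
    using assms cinner_self_pos[OF assms]
    by (auto simp: s_def dq_norm2_def a_def dual_sqrt_square dual.map_sel)
  have rs: "s * r = 1" using s0 by (simp add: r_def dual_inverse)
  have "cinner (dq_normalize x) (dq_normalize x) = (\<Sum>k<n. of_dual r * (star (x $ k) * x $ k) * of_dual r)"
    using x by (subst cinner_sum[of _ n])
      (auto simp: dq_normalize_carrier dq_normalize_index star_mult star_of_dual mult.assoc r_def s_def)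
  also have "\<dots> = of_dual r * of_dual a * of_dual r"
    unfolding a_def cinner_self_dual by (simp add: cinner_sum[OF x x] sum_distrib_left sum_distrib_right)
  also have "\<dots> = of_dual (r * a * r)" by (simp add: of_dual_mult)
  also have "r * a * r = (s * r) * (s * r)" by (simp add: ss[symmetric] mult_ac)
  finally show "cinner (dq_normalize x) (dq_normalize x) = 1"
    by (simp add: rs of_dual_one)
qed


text \<open>A retained residual is a right linear combination of eigenvectors for \<open>a\<close>, hence satisfies the
  eigenvalue equation because the dual number \<open>a\<close> is central; it is appreciable, so it can be normalized
  and is an eigenvector.\<close>

lemma orthogonalization_step:
  assumes Q: "Q \<in> carrier_mat n n" and v: "dq_eigenvector Q v a"
    and us: "\<And>u. u \<in> set us \<Longrightarrow> dq_eigenvector Q u a" "distinct us" "orthonormal (set us)"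
    and appr: "appreciable (dq_residual us v)"
  defines "w \<equiv> dq_normalize (dq_residual us v)"
  shows "dq_eigenvector Q w a" "w \<notin> set us" "orthonormal (set (us @ [w]))"
    and "v \<in> std_span n (set (us @ [w]))"
proof -
  define r where "r = dq_residual us v"
  define s where "s = dq_norm2 r"
  define i where "i = dual_inverse s"
  have vc: "v \<in> carrier_vec n" and uc: "set us \<subseteq> carrier_vec n"
    using dq_eigenvector_carrier[OF Q] v us(1) by blast+
  have rc: "r \<in> carrier_vec n"
    unfolding r_def by (rule dq_residual_carrier[OF vc])
  have wc: "w \<in> carrier_vec n"
    unfolding w_def r_def[symmetric] by (rule dq_normalize_carrier[OF rc])
  have w_idx: "w $ k = r $ k * of_dual i" if "k < n" for k
    unfolding w_def r_def[symmetric] i_def s_def by (rule dq_normalize_index[OF rc that])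
  have s0: "std_part s \<noteq> 0"
    using appr std_part_dq_norm2_pos_iff[of r] by (simp add: s_def r_def)
  have ias: "i * s = 1"
    using dual_inverse[OF s0] by (simp add: i_def mult.commute)
  have r_w: "r $ k = w $ k * of_dual s" if "k < n" for k
    by (simp add: w_idx[OF that] mult.assoc ias of_dual_one flip: of_dual_mult)
  have uw: "cinner u w = 0" if "u \<in> set us" for u
  proof -
    have u: "u \<in> carrier_vec n" using uc that by auto
    have "cinner u w = cinner u r * of_dual i"
      by (simp add: cinner_sum[OF u wc] cinner_sum[OF u rc] w_idx sum_distrib_right mult.assoc)
    also have "cinner u r = 0"
      unfolding r_def by (rule dq_residual_orthogonal[OF vc uc us(2,3) that])
    finally show ?thesis by simp
  qed
  have wu: "cinner w u = 0" if "u \<in> set us" for u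
  proof -
    have "dim_vec u = dim_vec w" using uc wc that by auto
    from star_cinner[OF this] show ?thesis by (simp add: uw[OF that])
  qed
  have ww: "cinner w w = 1"
    unfolding w_def by (rule dq_normalize_norm[OF appr])
  show wn: "w \<notin> set us"
    using uw ww by force
  show "orthonormal (set (us @ [w]))"
    using us(3) uw wu ww wn by (auto simp: orthonormal_def)
  show "dq_eigenvector Q w a"
    unfolding dq_eigenvector_iff[OF Q]
  proof (intro conjI allI impI)
    obtain k where k: "k < n" "std_part (r $ k) \<noteq> 0"
      using appr appreciable_iff[OF rc] by (auto simp: r_def)
    then show "\<exists>k<n. std_part (w $ k) \<noteq> 0"
      using r_w by fastforce
    fix j assume j: "j < n"
    have "(\<Sum>k<n. Q $$ (j, k) * w $ k) = (\<Sum>k<n. Q $$ (j, k) * r $ k) * of_dual i"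
      by (simp add: w_idx sum_distrib_right mult.assoc)
    also have "\<dots> = r $ j * of_dual a * of_dual i"
      unfolding r_def by (simp add: dq_residual_eigen_equation[OF Q v us(1,2) j])
    also have "\<dots> = w $ j * of_dual a"
      by (simp add: w_idx[OF j] mult.assoc mult.commute[of a] flip: of_dual_mult)
    finally show "(\<Sum>k<n. Q $$ (j, k) * w $ k) = w $ j * of_dual a" .
  qed (rule wc)
  \<comment> \<open>The residual is \<open>w\<close> times its norm \<open>s\<close>, which is therefore the coefficient of \<open>w\<close>.\<close>
  define c where "c = (\<lambda>u. if u = w then std_part (of_dual s) else std_part (cinner u v))"
  have "std_part (v $ k) = (\<Sum>u\<in>set (us @ [w]). std_part (u $ k) * c u)" if k: "k < n" for k
  proof -
    have "v $ k = w $ k * of_dual s + (\<Sum>u\<in>set us. u $ k * cinner u v)"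
      using dq_residual_index[OF vc uc us(2) k] r_w[OF k] by (simp add: r_def algebra_simps)
    then have "std_part (v $ k) = std_part (w $ k) * c w + (\<Sum>u\<in>set us. std_part (u $ k) * std_part (cinner u v))"
      by (simp add: std_part_sum c_def)
    also have "(\<Sum>u\<in>set us. std_part (u $ k) * std_part (cinner u v)) = (\<Sum>u\<in>set us. std_part (u $ k) * c u)"
      using wn by (intro sum.cong refl) (auto simp: c_def)
    finally show ?thesis using wn by simp
  qed
  then show "v \<in> std_span n (set (us @ [w]))"
    unfolding std_span_def mem_Collect_eq by (intro exI[of _ c]) simp
qed

lemma residual_not_appreciable_in_std_span:
  assumes "v \<in> carrier_vec n" "set us \<subseteq> carrier_vec n" "distinct us"
    and "\<not> appreciable (dq_residual us v)"
  shows "v \<in> std_span n (set us)"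
proof -
  have "std_part (v $ k) = (\<Sum>u\<in>set us. std_part (u $ k) * std_part (cinner u v))" if k: "k < n" for k
  proof -
    have "std_part (dq_residual us v $ k) = 0"
      using assms(4) k appreciable_iff[OF dq_residual_carrier[OF assms(1)]] by blast
    then show ?thesis
      by (simp add: dq_residual_index[OF assms(1-3) k] std_part_sum)
  qed
  then show ?thesis
    unfolding std_span_def mem_Collect_eq by (intro exI[of _ "\<lambda>u. std_part (cinner u v)"]) simp
qed

text \<open>The invariant of the orthogonalization loop: the vectors collected so far are orthonormal
  eigenvectors, none is ever removed, and every processed vector lies in their span up to infinitesimals.\<close>

lemma dq_orth_loop_correct:
  assumes Q: "Q \<in> carrier_mat n n"
    and "\<And>v. v \<in> set vs \<Longrightarrow> dq_eigenvector Q v a"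
    and "\<And>u. u \<in> set us \<Longrightarrow> dq_eigenvector Q u a" "distinct us" "orthonormal (set us)"
  defines "ws \<equiv> dq_orth_loop us vs"
  shows "(\<forall>w\<in>set ws. dq_eigenvector Q w a) \<and> distinct ws \<and> orthonormal (set ws) \<and>
    set us \<subseteq> set ws \<and> set vs \<subseteq> std_span n (set ws)"
  using assms(2-5) unfolding ws_def
proof (induction vs arbitrary: us)
  case Nil
  then show ?case by simp
next
  case (Cons v vs)
  have v: "dq_eigenvector Q v a" and vs: "\<And>x. x \<in> set vs \<Longrightarrow> dq_eigenvector Q x a"
    using Cons.prems(1) by simp_all
  show ?case
  proof (cases "appreciable (dq_residual us v)")
    case True
    define w where "w = dq_normalize (dq_residual us v)"
    define us' where "us' = us @ [w]"
    note step = orthogonalization_step[OF Q v Cons.prems(2-4) True, folded w_def]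
    have us': "dq_eigenvector Q u a" if "u \<in> set us'" for u
      using that step(1) Cons.prems(2) by (auto simp: us'_def)
    have d: "distinct us'" using step(2) Cons.prems(3) by (simp add: us'_def)
    have loop: "dq_orth_loop us (v # vs) = dq_orth_loop us' vs"
      using True by (simp add: std_part_dq_norm2_pos_iff w_def us'_def Let_def)
    have "v \<in> std_span n (set us')" "orthonormal (set us')"
      using step(3,4) by (simp_all only: us'_def)
    moreover note IH = Cons.IH[OF vs us' d this(2)]
    ultimately have "v \<in> std_span n (set (dq_orth_loop us' vs))"
      using std_span_mono[of "set us'" "set (dq_orth_loop us' vs)" n] by auto
    moreover have "set us \<subseteq> set us'" by (auto simp: us'_def)
    ultimately show ?thesis using IH unfolding loop by auto
  next
    case False
    have c: "v \<in> carrier_vec n" "set us \<subseteq> carrier_vec n"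
      using dq_eigenvector_carrier[OF Q] v Cons.prems(2) by blast+
    have loop: "dq_orth_loop us (v # vs) = dq_orth_loop us vs"
      using False by (simp add: std_part_dq_norm2_pos_iff)
    note IH = Cons.IH[OF vs Cons.prems(2-4)]
    have "v \<in> std_span n (set us)"
      by (rule residual_not_appreciable_in_std_span[OF c Cons.prems(3) False])
    then have "v \<in> std_span n (set (dq_orth_loop us vs))"
      using IH std_span_mono[of "set us" "set (dq_orth_loop us vs)" n] by auto
    then show ?thesis using IH unfolding loop by auto
  qed
qed

text \<open>The first vector is normalized without a test; as it is appreciable, this agrees with processing
  it against an empty list of earlier vectors.\<close>

lemma dq_orthogonalize_eq_loop:
  assumes "\<And>v. v \<in> set vs \<Longrightarrow> appreciable v"
  shows "dq_orthogonalize vs = dq_orth_loop [] vs"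
proof (cases vs)
  case (Cons v vs')
  moreover have "dq_residual [] v = v"
    by (simp add: dq_residual_def vec_eq_iff)
  ultimately show ?thesis
    using assms by (simp add: std_part_dq_norm2_pos_iff)
qed simp

lemma dq_orthogonalize_correct:
  assumes Q: "Q \<in> carrier_mat n n"
    and vs: "\<And>v. v \<in> set vs \<Longrightarrow> dq_eigenvector Q v a"
  defines "ws \<equiv> dq_orthogonalize vs"
  shows "\<And>w. w \<in> set ws \<Longrightarrow> dq_eigenvector Q w a" "distinct ws" "orthonormal (set ws)"
    "set vs \<subseteq> std_span n (set ws)"
proof -
  have "appreciable v" if "v \<in> set vs" for v
    using vs[OF that] by (simp add: dq_eigenvector_def)
  then have "ws = dq_orth_loop [] vs"
    unfolding ws_def by (rule dq_orthogonalize_eq_loop)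
  then show "\<And>w. w \<in> set ws \<Longrightarrow> dq_eigenvector Q w a" "distinct ws" "orthonormal (set ws)"
    "set vs \<subseteq> std_span n (set ws)"
    using dq_orth_loop_correct[OF Q vs, of vs "[]"] by (simp_all add: orthonormal_def)
qed

section \<open>From dual complex to dual quaternion vectors\<close>

text \<open>One coordinate of \<open>\<F>\<^sup>-\<^sup>1\<close>: the arguments are the coordinates \<open>i\<close> and \<open>n + i\<close> of the dual complex
  vector.\<close>

definition dq_of_dc :: "complex dual \<Rightarrow> complex dual \<Rightarrow> quat dual" where
  "dq_of_dc a b = map_dual quat_of_complex a - map_dual quat_of_complex (star b) * Dual quat_j 0"

lemma quat_of_complex_sel [simp]:
  "qre (quat_of_complex z) = Re z" "qi (quat_of_complex z) = Im z"
  "qj (quat_of_complex z) = 0" "qk (quat_of_complex z) = 0"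
  by (simp_all add: quat_of_complex_def)

lemma quat_j_sel [simp]: "qre quat_j = 0" "qi quat_j = 0" "qj quat_j = 1" "qk quat_j = 0"
  by (simp_all add: quat_j_def)

lemma dq_of_dc_sum: "dq_of_dc (sum f A) (sum g A) = (\<Sum>x\<in>A. dq_of_dc (f x) (g x))"
proof -
  have "dq_of_dc 0 0 = 0"
    by (intro dual.expand) (simp add: dq_of_dc_def quat.expand dual.map_sel star_complex_def)
  moreover have "dq_of_dc (a + a') (b + b') = dq_of_dc a b + dq_of_dc a' b'" for a a' b b'
    by (intro dual.expand) (simp add: dq_of_dc_def quat.expand dual.map_sel star_complex_def)
  ultimately show ?thesis
    by (induction A rule: infinite_finite_induct) auto
qed

text \<open>Right linearity over the dual complex numbers, since \<open>j c\<close> is the conjugate of \<open>c\<close> times \<open>j\<close>.\<close>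

lemma dq_of_dc_mult: "dq_of_dc (a * c) (b * c) = dq_of_dc a b * map_dual quat_of_complex c"
  by (intro dual.expand)
    (simp add: dq_of_dc_def quat.expand dual.map_sel star_complex_def algebra_simps)

text \<open>The case \<open>n = 1\<close> of \<open>\<F>\<^sup>-\<^sup>1 (\<J> Q u) = Q \<F>\<^sup>-\<^sup>1 u\<close>; the general case is a sum of these.\<close>

lemma dq_of_dc_adjoint:
  fixes q :: "quat dual"
  defines "a \<equiv> map_dual cpart1 q" and "b \<equiv> map_dual cpart2 q"
  shows "dq_of_dc (a * x + b * y) (- star b * x + star a * y) = q * dq_of_dc x y"
  by (intro dual.expand)
    (simp add: a_def b_def cpart1_def cpart2_def dq_of_dc_def quat.expand dual.map_sel
      star_complex_def algebra_simps)

lemma dq_of_dc_std_eq_0: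
  assumes "std_part (dq_of_dc a b) = 0"
  shows "std_part a = 0 \<and> std_part b = 0"
proof -
  have "std_part (dq_of_dc a b) = Quat (Re (std_part a)) (Im (std_part a)) (- Re (std_part b)) (Im (std_part b))"
    by (simp add: dq_of_dc_def quat.expand dual.map_sel star_complex_def)
  then show ?thesis
    using assms by (simp add: zero_quat_def complex_eq_iff)
qed

lemma F_inv_index: "k < n \<Longrightarrow> F_inv n u $ k = dq_of_dc (u $ k) (u $ (n + k))"
  by (simp add: F_inv_def dq_of_dc_def)

lemma F_inv_carrier: "F_inv n u \<in> carrier_vec n"
  by (simp add: F_inv_def)

lemma dc_adjoint_row:
  assumes Q: "Q \<in> carrier_mat n n" and u: "u \<in> carrier_vec (2 * n)" and i: "i < n"
  shows "(dc_adjoint Q *\<^sub>v u) $ i = (\<Sum>k<n. map_dual cpart1 (Q $$ (i, k)) * u $ k +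
      map_dual cpart2 (Q $$ (i, k)) * u $ (n + k))"
    and "(dc_adjoint Q *\<^sub>v u) $ (n + i) = (\<Sum>k<n. - star (map_dual cpart2 (Q $$ (i, k))) * u $ k +
      star (map_dual cpart1 (Q $$ (i, k))) * u $ (n + k))"
proof -
  have split: "(\<Sum>k\<in>{0..<n + n}. f k) = (\<Sum>k<n. f k + f (n + k))" for f :: "nat \<Rightarrow> complex dual"
  proof -
    have "(\<Sum>k\<in>{0..<n + n}. f k) = (\<Sum>k\<in>{0..<n}. f k) + (\<Sum>k\<in>{0 + n..<n + n}. f k)"
      by (subst sum.atLeastLessThan_concat[symmetric, of 0 n]) auto
    also have "(\<Sum>k\<in>{0 + n..<n + n}. f k) = (\<Sum>k\<in>{0..<n}. f (k + n))"
      by (rule sum.shift_bounds_nat_ivl)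
    finally show ?thesis
      by (simp add: sum.distrib atLeast0LessThan add.commute)
  qed
  show "(dc_adjoint Q *\<^sub>v u) $ i = (\<Sum>k<n. map_dual cpart1 (Q $$ (i, k)) * u $ k +
      map_dual cpart2 (Q $$ (i, k)) * u $ (n + k))"
    "(dc_adjoint Q *\<^sub>v u) $ (n + i) = (\<Sum>k<n. - star (map_dual cpart2 (Q $$ (i, k))) * u $ k +
      star (map_dual cpart1 (Q $$ (i, k))) * u $ (n + k))"
    using Q u i by (auto simp: dc_adjoint_def Let_def scalar_prod_def mult_2 split intro!: sum.cong)
qed

lemma F_inv_dc_adjoint:
  assumes Q: "Q \<in> carrier_mat n n" and u: "u \<in> carrier_vec (2 * n)" and i: "i < n"
  shows "F_inv n (dc_adjoint Q *\<^sub>v u) $ i = (\<Sum>k<n. Q $$ (i, k) * F_inv n u $ k)"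
  unfolding F_inv_index[OF i] dc_adjoint_row[OF assms] dq_of_dc_sum dq_of_dc_adjoint
  by (simp add: F_inv_index)

lemma map_dual_quat_of_complex_of_dual: "map_dual quat_of_complex (of_dual a) = of_dual a"
  by (intro dual.expand) (simp add: dual.map_sel quat.expand of_real_def)

lemma unitary_column_appreciable:
  fixes U :: "complex dual mat"
  assumes U: "unitary N U" and c: "c < N"
  shows "\<exists>k<N. std_part (U $$ (k, c)) \<noteq> 0"
proof (rule ccontr)
  assume *: "\<not> ?thesis"
  have Uc: "U \<in> carrier_mat N N" using U by (simp add: unitary_def)
  have "1 = std_part ((ctranspose U * U) $$ (c, c))"
    using U c by (simp add: unitary_def)
  also have "\<dots> = 0"
    using Uc c * by (simp add: ctranspose_def scalar_prod_def std_part_sum)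
  finally show False by simp
qed

text \<open>The image is appreciable because \<open>\<F>\<^sup>-\<^sup>1\<close> is injective on standard parts and a unitary matrix has no
  infinitesimal column.\<close>

lemma F_inv_column_eigenvector:
  assumes Q: "Q \<in> carrier_mat n n" and U: "unitary (2 * n) U" and c: "c < 2 * n"
    and eig: "dc_adjoint Q *\<^sub>v col U c = of_dual a \<cdot>\<^sub>v col U c"
  shows "dq_eigenvector Q (F_inv n (col U c)) a"
  unfolding dq_eigenvector_iff[OF Q]
proof (intro conjI allI impI)
  have Uc: "U \<in> carrier_mat (2 * n) (2 * n)" using U by (simp add: unitary_def)
  then have u: "col U c \<in> carrier_vec (2 * n)" using c by simp
  show "F_inv n (col U c) \<in> carrier_vec n" by (rule F_inv_carrier)
  show "\<exists>k<n. std_part (F_inv n (col U c) $ k) \<noteq> 0"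
  proof (rule ccontr)
    assume *: "\<not> ?thesis"
    have 0: "std_part (U $$ (k, c)) = 0 \<and> std_part (U $$ (n + k, c)) = 0" if "k < n" for k
      using * that Uc c by (intro dq_of_dc_std_eq_0) (auto simp: F_inv_index)
    have "std_part (U $$ (k, c)) = 0" if "k < 2 * n" for k
    proof (cases "k < n")
      case False
      then show ?thesis using 0[of "k - n"] that by simp
    qed (simp add: 0)
    then show False using unitary_column_appreciable[OF U c] by auto
  qed
  fix i assume i: "i < n"
  have "(\<Sum>k<n. Q $$ (i, k) * F_inv n (col U c) $ k) = F_inv n (of_dual a \<cdot>\<^sub>v col U c) $ i"
    unfolding F_inv_dc_adjoint[OF Q u i, symmetric] eig ..
  also have "\<dots> = F_inv n (col U c) $ i * of_dual a"
    using Uc c i by (simp add: F_inv_index mult.commute[of "of_dual a"] dq_of_dc_mult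
        map_dual_quat_of_complex_of_dual)
  finally show "(\<Sum>k<n. Q $$ (i, k) * F_inv n (col U c) $ k) = F_inv n (col U c) $ i * of_dual a" .
qed

text \<open>Apply the right linear map \<open>\<F>\<^sup>-\<^sup>1\<close> to column \<open>m\<close> of \<open>U U\<^sup>* = I\<close>.\<close>

lemma unit_vec_F_inv_combination:
  assumes U: "unitary (2 * n) U" and m: "m < n" and k: "k < n"
  shows "unit_vec n m $ k =
    (\<Sum>c<2 * n. F_inv n (col U c) $ k * map_dual quat_of_complex (star (U $$ (m, c))))"
proof -
  have Uc: "U \<in> carrier_mat (2 * n) (2 * n)" using U by (simp add: unitary_def)
  have row: "(\<Sum>c<2 * n. U $$ (r, c) * star (U $$ (m, c))) = (if r = m then 1 else 0)" if "r < 2 * n" for r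
  proof -
    have "(U * ctranspose U) $$ (r, m) = (if r = m then 1 else 0)"
      using U that m by (simp add: unitary_def)
    then show ?thesis
      using Uc that m by (simp add: ctranspose_def scalar_prod_def atLeast0LessThan)
  qed
  have "(\<Sum>c<2 * n. F_inv n (col U c) $ k * map_dual quat_of_complex (star (U $$ (m, c)))) =
     dq_of_dc (\<Sum>c<2 * n. U $$ (k, c) * star (U $$ (m, c))) (\<Sum>c<2 * n. U $$ (n + k, c) * star (U $$ (m, c)))"
    unfolding dq_of_dc_sum dq_of_dc_mult using Uc k by (intro sum.cong refl) (simp add: F_inv_index)
  also have "\<dots> = dq_of_dc (if k = m then 1 else 0) 0"
    using m k by (simp add: row)
  also have "\<dots> = (if k = m then 1 else 0)"
    by (auto intro!: dual.expand simp: dq_of_dc_def quat.expand dual.map_sel star_complex_def)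
  finally show ?thesis using m k by simp
qed

section \<open>Diagonal matrices with scalar blocks\<close>

lemma diag_block_mat_scalar_blocks:
  "diag_block_mat (map (\<lambda>(c, t). c \<cdot>\<^sub>m 1\<^sub>m t) xs) =
    (let ys = concat (map (\<lambda>(c, t). replicate t c) xs) in
      mat_diag (length ys) (\<lambda>k. ys ! k :: 'a::ring_1))"
proof (induction xs)
  case Nil
  then show ?case by (auto simp: mat_diag_def)
next
  case (Cons x xs)
  obtain c t where x: "x = (c, t)" by fastforce
  show ?case
    unfolding x list.map prod.case diag_block_mat.simps Cons.IH
    by (rule eq_matI) (auto simp: Let_def mat_diag_def nth_append)
qed

lemma concat_replicate_nth:
  assumes "i < l" "j < t i"
  shows "(\<Sum>k<i. t k) + j < (\<Sum>k<l. t k)"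
    and "concat (map (\<lambda>i. replicate (t i) (c i)) [0..<l]) ! ((\<Sum>k<i. t k) + j) = c i"
proof -
  have len: "length (concat (map (\<lambda>i. replicate (t i) (c i)) [0..<l])) = (\<Sum>k<l. t k)" for l
    by (induction l) auto
  have lt: "(\<Sum>k<i. t k) + j < (\<Sum>k<l. t k)" if "i < l" "j < t i" for i l j
  proof -
    have "(\<Sum>k<i. t k) + j < (\<Sum>k<Suc i. t k)" using that by simp
    also have "\<dots> \<le> (\<Sum>k<l. t k)" using that by (intro sum_mono2) auto
    finally show ?thesis .
  qed
  from this[OF assms] show "(\<Sum>k<i. t k) + j < (\<Sum>k<l. t k)" .
  show "concat (map (\<lambda>i. replicate (t i) (c i)) [0..<l]) ! ((\<Sum>k<i. t k) + j) = c i"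
    using assms
  proof (induction l)
    case (Suc l)
    show ?case
    proof (cases "i = l")
      case True
      then show ?thesis using Suc.prems by (simp add: nth_append len)
    next
      case False
      then have "i < l" using Suc.prems by simp
      then show ?thesis using Suc lt by (simp add: nth_append len)
    qed
  qed simp
qed

lemma block_index_surj:
  fixes t :: "nat \<Rightarrow> nat" and l :: nat
  shows "c < (\<Sum>k<l. t k) \<Longrightarrow> \<exists>i<l. \<exists>j<t i. c = (\<Sum>k<i. t k) + j"
proof (induction l)
  case (Suc l)
  show ?case
  proof (cases "c < (\<Sum>k<l. t k)")
    case True
    then show ?thesis using Suc.IH less_SucI by blast
  next
    case False
    then show ?thesis using Suc.prems
      by (intro exI[of _ l] conjI exI[of _ "c - (\<Sum>k<l. t k)"]) auto
  qed
qed simp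


section \<open>Completeness of an eigenbasis with orthonormal standard parts\<close>

lemma map_std_part_mult:
  fixes A B :: "'a::ring_1 dual mat"
  assumes "A \<in> carrier_mat n m" "B \<in> carrier_mat m k"
  shows "map_mat std_part (A * B) = map_mat std_part A * map_mat std_part B"
  using assms by (intro eq_matI) (auto simp: scalar_prod_def std_part_sum)

text \<open>Write \<open>E = I + R \<epsilon>\<close>. Then \<open>E\<^sup>2 = I + 2 R \<epsilon>\<close>, so \<open>R = 0\<close>. This replaces an argument by
  invertibility when \<open>V V\<^sup>* = I\<close> has to be derived from \<open>V\<^sup>* V = I\<close>, as \<open>V V\<^sup>*\<close> is idempotent.\<close>

lemma idempotent_std_identity:
  fixes E :: "'a::ring_1 dual mat"
  assumes E: "E \<in> carrier_mat n n" and idem: "E * E = E" and std: "map_mat std_part E = 1\<^sub>m n"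
  shows "E = 1\<^sub>m n"
proof (rule eq_matI)
  fix i j assume "i < dim_row (1\<^sub>m n :: 'a dual mat)" "j < dim_col (1\<^sub>m n :: 'a dual mat)"
  then have ij: "i < n" "j < n" by simp_all
  have s: "std_part (E $$ (i, j)) = (if i = j then 1 else 0)" if "i < n" "j < n" for i j
    using arg_cong[OF std, of "\<lambda>A. A $$ (i, j)"] E that by simp
  have "inf_part (E $$ (i, j)) = inf_part ((E * E) $$ (i, j))"
    by (simp add: idem)
  also have "\<dots> = (\<Sum>k<n. std_part (E $$ (i, k)) * inf_part (E $$ (k, j))
      + inf_part (E $$ (i, k)) * std_part (E $$ (k, j)))"
    using E ij by (simp add: scalar_prod_def inf_part_sum atLeast0LessThan)
  also have "\<dots> = (\<Sum>k<n. if k = i then inf_part (E $$ (k, j)) else 0)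
      + (\<Sum>k<n. if k = j then inf_part (E $$ (i, k)) else 0)"
    using ij unfolding sum.distrib[symmetric] by (intro sum.cong refl) (auto simp: s)
  also have "\<dots> = inf_part (E $$ (i, j)) + inf_part (E $$ (i, j))"
    using ij by simp
  finally have "inf_part (E $$ (i, j)) = 0" by simp
  then show "E $$ (i, j) = 1\<^sub>m n $$ (i, j)"
    using ij by (intro dual.expand) (simp add: s)
qed (use E in auto)

text \<open>A matrix that is unitary up to an infinitesimal becomes unitary by the factor \<open>I - K\<close>, which is
  the inverse square root of the Gram matrix \<open>I + 2 K\<close> because \<open>K\<^sup>2 = 0\<close>. As \<open>K\<close> commutes with
  \<open>L\<close>, so does the factor, and \<open>Q W = W L\<close> passes on to the corrected matrix.\<close>

lemma infinitesimal_correction: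
  fixes W :: "quat dual mat"
  assumes W: "W \<in> carrier_mat n n" and K: "K \<in> carrier_mat n n" "ctranspose K = K" "K * K = 0\<^sub>m n n"
    and gram: "ctranspose W * W = 1\<^sub>m n + K + K"
    and stdK: "map_mat std_part K = 0\<^sub>m n n"
    and stdW: "map_mat std_part (W * ctranspose W) = 1\<^sub>m n"
    and Q: "Q \<in> carrier_mat n n" and L: "L \<in> carrier_mat n n" "Q * W = W * L" "K * L = L * K"
  defines "V \<equiv> W * (1\<^sub>m n - K)"
  shows "unitary n V" "ctranspose V * Q * V = L"
proof -
  define C where "C = 1\<^sub>m n - K"
  define T where "T = ctranspose W"
  have C: "C \<in> carrier_mat n n" unfolding C_def by (rule minus_carrier_mat[OF K(1)])
  have T: "T \<in> carrier_mat n n" unfolding T_def by (rule ctranspose_carrier[OF W])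
  have V: "V = W * C" by (simp add: V_def C_def)
  have Vc: "V \<in> carrier_mat n n" unfolding V by (rule mult_carrier_mat[OF W C])
  have one: "ctranspose (1\<^sub>m n) = (1\<^sub>m n :: quat dual mat)"
    by (rule eq_matI) (auto simp: ctranspose_def)
  have starK: "star (K $$ (j, i)) = K $$ (i, j)" if "i < n" "j < n" for i j
    using arg_cong[OF K(2), of "\<lambda>A. A $$ (i, j)"] K(1) that by (simp add: ctranspose_def)
  have star_diff: "star (a - b) = star a - star b" for a b :: "quat dual"
    using star_add[of "a - b" b] by (simp add: algebra_simps)
  have CT: "ctranspose C = C"
    using K(1) by (intro eq_matI) (auto simp: C_def ctranspose_def star_diff starK)
  have VT: "ctranspose V = C * T"
    unfolding V ctranspose_mult[OF W C] CT T_def ..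
  note am = assoc_mult_mat[where ?n\<^sub>1.0 = n and ?n\<^sub>2.0 = n and ?n\<^sub>3.0 = n and ?n\<^sub>4.0 = n]
  have mc: "A * B \<in> carrier_mat n n" if "A \<in> carrier_mat n n" "B \<in> carrier_mat n n"
    for A B :: "quat dual mat" using that by simp
  have gramT: "T * W = 1\<^sub>m n + K + K" using gram by (simp add: T_def)
  have CG: "C * (1\<^sub>m n + K + K) = 1\<^sub>m n + K"
  proof -
    have "C * (1\<^sub>m n + K + K) = (1\<^sub>m n + K + K) - K * (1\<^sub>m n + K + K)"
      unfolding C_def using K(1) by (subst minus_mult_distrib_mat[of _ n n]) auto
    also have "K * (1\<^sub>m n + K + K) = K"
      using K(1,3) by (simp add: mult_add_distrib_mat[of _ n n _ n])
    also have "(1\<^sub>m n + K + K) - K = 1\<^sub>m n + K"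
      using K(1) by (intro eq_matI) auto
    finally show ?thesis .
  qed
  have KC: "(1\<^sub>m n + K) * C = 1\<^sub>m n"
  proof -
    have "(1\<^sub>m n + K) * C = (1\<^sub>m n + K) - (1\<^sub>m n + K) * K"
      unfolding C_def using K(1) by (subst mult_minus_distrib_mat[of _ n n]) auto
    also have "(1\<^sub>m n + K) * K = K"
      using K(1,3) by (simp add: add_mult_distrib_mat[of _ n n])
    also have "(1\<^sub>m n + K) - K = 1\<^sub>m n"
      using K(1) by (intro eq_matI) auto
    finally show ?thesis .
  qed
  have CTW: "C * (T * W) = 1\<^sub>m n + K" by (simp add: gramT CG)
  have VV: "ctranspose V * V = 1\<^sub>m n"
  proof -
    have "ctranspose V * V = C * (T * W) * C"
      unfolding VT unfolding V using C T W by (simp add: am mc)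
    then show ?thesis by (simp add: CTW KC)
  qed
  have LC: "L * C = C * L"
  proof -
    have "L * C = L - L * K"
      unfolding C_def using K(1) L(1) by (subst mult_minus_distrib_mat[of _ n n]) auto
    also have "\<dots> = C * L"
      unfolding C_def using K(1) L(1) by (subst minus_mult_distrib_mat[of _ n n]) (auto simp: L(3))
    finally show ?thesis .
  qed
  have "ctranspose V * Q * V = C * T * (Q * W) * C"
    unfolding VT unfolding V using C T W Q by (simp add: am mc)
  also have "\<dots> = C * (T * W) * (L * C)"
    unfolding L(2) using C T W L(1) by (simp add: am mc)
  also have "\<dots> = (1\<^sub>m n + K) * C * L"
    unfolding CTW LC using C K(1) L(1) by (simp add: am)
  also have "\<dots> = L" unfolding KC using L(1) by simp
  finally show "ctranspose V * Q * V = L" .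
  have VTc: "ctranspose V \<in> carrier_mat n n" by (rule ctranspose_carrier[OF Vc])
  \<comment> \<open>Over a noncommutative ring \<open>V V\<^sup>* = I\<close> is not a formal consequence of \<open>V\<^sup>* V = I\<close>; it comes
    from the corresponding property of the standard part of \<open>W\<close>.\<close>
  define E where "E = V * ctranspose V"
  have Ec: "E \<in> carrier_mat n n" unfolding E_def by (rule mc[OF Vc VTc])
  have "E * E = V * (ctranspose V * V) * ctranspose V"
    unfolding E_def using Vc VTc by (simp add: am mc)
  then have "E * E = E" unfolding VV using Vc by (simp add: E_def)
  moreover have "map_mat std_part E = 1\<^sub>m n"
  proof -
    have stdC: "map_mat std_part C = 1\<^sub>m n"
    proof (rule eq_matI)
      fix i j assume "i < dim_row (1\<^sub>m n :: quat mat)" "j < dim_col (1\<^sub>m n :: quat mat)"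
      then show "map_mat std_part C $$ (i, j) = 1\<^sub>m n $$ (i, j)"
        using arg_cong[OF stdK, of "\<lambda>A. A $$ (i, j)"] K(1) by (simp add: C_def)
    qed (use C in auto)
    have sc: "map_mat std_part A \<in> carrier_mat n n" if "A \<in> carrier_mat n n"
      for A :: "quat dual mat" using that by simp
    have "E = W * (C * C) * T"
      unfolding E_def VT unfolding V using C W T by (simp add: am mc)
    then have "map_mat std_part E = map_mat std_part W * map_mat std_part T"
      using W T C by (simp add: map_std_part_mult[where n = n and m = n and k = n] mc stdC sc
          right_mult_one_mat[OF sc])
    also have "\<dots> = 1\<^sub>m n"
      using stdW W T by (simp add: map_std_part_mult[where n = n and m = n and k = n] flip: T_def)
    finally show ?thesis .
  qed
  ultimately have "V * ctranspose V = 1\<^sub>m n"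
    unfolding E_def[symmetric] by (rule idempotent_std_identity[OF Ec])
  with VV Vc show "unitary n V" by (simp add: unitary_def)
qed

text \<open>Pairing a vanishing combination with each \<open>y \<in> X\<close> first gives that all coefficients are infinitesimal,
  by the standard part of the equation. With this, the infinitesimal part of the same equation contains
  only standard parts of inner products.\<close>

lemma std_basis_rlin_independent:
  assumes X: "finite X" "X \<subseteq> carrier_vec n" "std_orthonormal X"
  shows "rlin_independent n X"
  unfolding rlin_independent_def
proof (intro allI impI ballI)
  fix c y assume c: "\<forall>k<n. (\<Sum>x\<in>X. x $ k * c x) = 0" and y: "y \<in> X"
  have gram0: "(\<Sum>x\<in>X. cinner y x * c x) = 0" if "y \<in> X" for y
  proof -
    have "(\<Sum>x\<in>X. cinner y x * c x) = (\<Sum>x\<in>X. \<Sum>k<n. star (y $ k) * (x $ k * c x))"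
    proof (intro sum.cong refl)
      fix x assume "x \<in> X"
      then have "x \<in> carrier_vec n" "y \<in> carrier_vec n" using X(2) that by auto
      then show "cinner y x * c x = (\<Sum>k<n. star (y $ k) * (x $ k * c x))"
        by (simp add: cinner_sum sum_distrib_right mult.assoc)
    qed
    also have "\<dots> = (\<Sum>k<n. \<Sum>x\<in>X. star (y $ k) * (x $ k * c x))"
      by (rule sum.swap)
    also have "\<dots> = 0"
      using c by (simp flip: sum_distrib_left)
    finally show ?thesis .
  qed
  have on: "std_part (cinner y x) = (if x = y then 1 else 0)" if "x \<in> X" "y \<in> X" for x y
    using X(3) that by (auto simp: std_orthonormal_def)
  have std: "std_part (c y) = 0" if y: "y \<in> X" for y
  proof -
    have "0 = (\<Sum>x\<in>X. std_part (cinner y x) * std_part (c x))"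
      using arg_cong[OF gram0[OF y], of std_part] by (simp add: std_part_sum)
    also have "\<dots> = (\<Sum>x\<in>X. if x = y then std_part (c x) else 0)"
      using y by (intro sum.cong refl) (simp add: on)
    finally show ?thesis using X(1) y by simp
  qed
  have "0 = (\<Sum>x\<in>X. std_part (cinner y x) * inf_part (c x))"
    using arg_cong[OF gram0[OF y], of inf_part] std by (simp add: inf_part_sum)
  also have "\<dots> = (\<Sum>x\<in>X. if x = y then inf_part (c x) else 0)"
    using y by (intro sum.cong refl) (simp add: on)
  finally have "inf_part (c y) = 0" using X(1) y by simp
  with std[OF y] show "c y = 0" by (intro dual.expand) simp
qed

lemma quat_half_add: "(1/2) *\<^sub>R p + (1/2) *\<^sub>R p = (p :: quat)"
  by (simp add: quat.expand)

text \<open>The vectors in \<open>X\<close> may fail to be orthogonal by infinitesimals, so the unitary diagonalization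
  that exhibits the eigenvalues does not have \<open>X\<close> itself as its set of columns, but the corrected matrix
  of \<open>infinitesimal_correction\<close>.\<close>

lemma std_eigenbasis_complete:
  assumes Q: "Q \<in> carrier_mat n n" "hermitian Q" and X: "finite X" "std_orthonormal X"
    and eig: "\<And>x. x \<in> X \<Longrightarrow> dq_eigenvector Q x (\<mu> x)"
    and span: "\<And>m. m < n \<Longrightarrow> unit_vec n m \<in> std_span n X"
  shows "complete_eigenvector_set Q X"
proof -
  have Xc: "X \<subseteq> carrier_vec n"
    using dq_eigenvector_carrier[OF Q(1)] eig by blast
  note res = std_resolution_of_identity[OF X(1) Xc X(2) span]
  have "card X = n"
    by (rule std_basis_card[OF X(1) Xc X(2)]) (simp add: res)
  then obtain f where f: "bij_betw f {..<n} X"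
    using ex_bij_betw_nat_finite[OF X(1)] by (auto simp: atLeast0LessThan)
  have fX: "f j \<in> X" if "j < n" for j using f that by (auto simp: bij_betw_def)
  have fc: "f j \<in> carrier_vec n" if "j < n" for j using fX[OF that] Xc by auto
  have fe: "dq_eigenvector Q (f j) (\<mu> (f j))" if "j < n" for j using eig[OF fX[OF that]] .
  have feq: "f i = f j \<longleftrightarrow> i = j" if "i < n" "j < n" for i j
    using f that by (auto simp: bij_betw_def inj_on_def)
  define W where "W = mat n n (\<lambda>(k, j). f j $ k)"
  define L where "L = mat_diag n (\<lambda>j. of_dual (\<mu> (f j)) :: quat dual)"
  \<comment> \<open>The inner products of distinct vectors are infinitesimal, so half the infinitesimal part of the
    Gram matrix is the \<open>K\<close> with \<open>W\<^sup>* W = I + 2 K\<close>.\<close>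
  define K where "K = mat n n (\<lambda>(i, j). Dual 0 ((1/2) *\<^sub>R inf_part (cinner (f i) (f j))))"
  have W: "W \<in> carrier_mat n n" and L: "L \<in> carrier_mat n n" and K: "K \<in> carrier_mat n n"
    by (simp_all add: W_def L_def K_def mat_diag_def)
  have std: "std_part (cinner (f i) (f j)) = (if i = j then 1 else 0)" if "i < n" "j < n" for i j
    using X(2) fX that feq by (auto simp: std_orthonormal_def)
  have gram: "ctranspose W * W = 1\<^sub>m n + K + K"
  proof (rule eq_matI)
    fix i j assume "i < dim_row (1\<^sub>m n + K + K)" "j < dim_col (1\<^sub>m n + K + K)"
    then have ij: "i < n" "j < n" using K by auto
    have "(ctranspose W * W) $$ (i, j) = cinner (f i) (f j)"
      using W ij by (simp add: ctranspose_def W_def scalar_prod_def cinner_sum[OF fc fc] atLeast0LessThan)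
    then show "(ctranspose W * W) $$ (i, j) = (1\<^sub>m n + K + K) $$ (i, j)"
      using ij by (intro dual.expand) (simp add: K_def std quat_half_add)
  qed (use W K in \<open>auto simp: ctranspose_def\<close>)
  have KT: "ctranspose K = K"
  proof (rule eq_matI)
    fix i j assume "i < dim_row K" "j < dim_col K"
    then have ij: "i < n" "j < n" using K by auto
    have d: "dim_vec (f j) = dim_vec (f i)" using fc ij by (metis carrier_vecD)
    have "star ((1/2) *\<^sub>R p) = (1/2) *\<^sub>R star p" for p :: quat
      by (simp add: quat.expand)
    then show "ctranspose K $$ (i, j) = K $$ (i, j)"
      using ij star_cinner[OF d, symmetric]
      by (intro dual.expand) (simp add: ctranspose_def K_def)
  qed (use K in \<open>auto simp: ctranspose_def\<close>)
  have KK: "K * K = 0\<^sub>m n n"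
  proof -
    have "Dual 0 p * Dual 0 q = 0" for p q :: quat
      by (rule dual.expand) simp
    then show ?thesis
      by (intro eq_matI) (auto simp: K_def scalar_prod_def)
  qed
  have stdK: "map_mat std_part K = 0\<^sub>m n n"
    by (intro eq_matI) (auto simp: K_def)
  have stdW: "map_mat std_part (W * ctranspose W) = 1\<^sub>m n"
  proof (rule eq_matI)
    fix i m assume "i < dim_row (1\<^sub>m n :: quat mat)" "m < dim_col (1\<^sub>m n :: quat mat)"
    then have im: "i < n" "m < n" by simp_all
    have "map_mat std_part (W * ctranspose W) $$ (i, m) =
        (\<Sum>j<n. std_part (f j $ i) * star (std_part (f j $ m)))"
      using W im by (simp add: ctranspose_def W_def scalar_prod_def std_part_sum atLeast0LessThan)
    also have "\<dots> = (\<Sum>x\<in>X. std_part (x $ i) * star (std_part (x $ m)))"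
      by (rule sum.reindex_bij_betw[OF f])
    finally show "map_mat std_part (W * ctranspose W) $$ (i, m) = 1\<^sub>m n $$ (i, m)"
      using im by (simp add: res)
  qed (use W in \<open>auto simp: ctranspose_def\<close>)
  have QW: "Q * W = W * L"
  proof (rule eq_matI)
    fix i j assume "i < dim_row (W * L)" "j < dim_col (W * L)"
    then have ij: "i < n" "j < n" using W L by auto
    have "(Q * W) $$ (i, j) = (\<Sum>k<n. Q $$ (i, k) * f j $ k)"
      using Q(1) W ij by (simp add: W_def scalar_prod_def atLeast0LessThan)
    also have "\<dots> = (W * L) $$ (i, j)"
      using ij dq_eigenvector_entry[OF Q(1) fe[OF ij(2)] ij(1)]
      by (simp add: L_def mat_diag_mult_right[OF W]) (simp add: W_def)
    finally show "(Q * W) $$ (i, j) = (W * L) $$ (i, j)" .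
  qed (use Q W L in auto)
  have KL: "K * L = L * K"
  proof (rule eq_matI)
    fix i j assume "i < dim_row (L * K)" "j < dim_col (L * K)"
    then have ij: "i < n" "j < n" using K L by auto
    have "K $$ (i, j) * of_dual (\<mu> (f j)) = of_dual (\<mu> (f i)) * K $$ (i, j)"
    proof (cases "std_part (\<mu> (f i)) = std_part (\<mu> (f j))")
      case True
      then show ?thesis using ij
        by (intro dual.expand) (simp add: K_def of_real_quat_central)
    next
      case False
      have "cinner (f i) (f j) = 0"
        by (rule eigenvectors_orthogonal[OF Q fe[OF ij(1)] fe[OF ij(2)] False])
      then have "K $$ (i, j) = 0"
        using ij by (intro dual.expand) (simp add: K_def)
      then show ?thesis by simp
    qed
    then show "(K * L) $$ (i, j) = (L * K) $$ (i, j)"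
      using ij K by (simp add: L_def mat_diag_mult_left[OF K] mat_diag_mult_right[OF K])
  qed (use K L in auto)
  note V = infinitesimal_correction[OF W K KT KK gram stdK stdW Q(1) L QW KL]
  have "image_mset \<mu> (mset_set X) = image_mset (\<lambda>j. \<mu> (f j)) (mset_set {..<n})"
  proof -
    have "mset_set X = image_mset f (mset_set {..<n})"
      using f by (simp add: bij_betw_def image_mset_mset_set)
    then show ?thesis by (simp add: multiset.map_comp o_def)
  qed
  then have "dq_eigenvalues Q (image_mset \<mu> (mset_set X))"
    using V Q(1) unfolding dq_eigenvalues_def L_def by auto
  then show ?thesis
    unfolding complete_eigenvector_set_def
    using X(1) std_basis_rlin_independent[OF X(1) Xc X(2)] eig Q(1) by auto
qed

section \<open>Eigenvectors from a diagonalization of the adjoint matrix\<close>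

theorem theorem5:
  fixes n l :: nat and t :: "nat \<Rightarrow> nat"
    and Q :: "quat dual mat" and U :: "complex dual mat"
    and lam :: "nat \<Rightarrow> real dual"
    and v :: "nat \<Rightarrow> nat \<Rightarrow> quat dual vec"
    and w :: "nat \<Rightarrow> quat dual vec list"
  assumes Q: "Q \<in> carrier_mat n n" "hermitian Q"
    and U: "unitary (2 * n) U"
    and t_pos: "\<And>i. i < l \<Longrightarrow> t i \<ge> 1"
    and lam_distinct: "inj_on lam {..<l}"
    and diag: "ctranspose U * dc_adjoint Q * U =
      diag_block_mat (map (\<lambda>i. of_dual (lam i) \<cdot>\<^sub>m 1\<^sub>m (t i)) [0..<l])"
    and v: "\<And>i j. i < l \<Longrightarrow> j < t i \<Longrightarrow> v i j = F_inv n (col U ((\<Sum>k<i. t k) + j))"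
    and w: "\<And>i. i < l \<Longrightarrow> w i = dq_orthogonalize (map (v i) [0..<t i])"
  shows "(\<forall>i<l.
      (\<forall>j<t i. dq_eigenvector Q (v i j) (lam i)) \<and>
      (\<forall>j<length (w i). dq_eigenvector Q (w i ! j) (lam i)) \<and>
      (\<forall>j<length (w i). \<forall>k<length (w i). j \<noteq> k \<longrightarrow> cinner (w i ! j) (w i ! k) = 0)) \<and>
    complete_eigenvector_set Q (\<Union>i<l. set (w i))"
proof -
  define N where "N = 2 * n"
  define P where "P = dc_adjoint Q"
  define ys :: "complex dual list" where "ys = concat (map (\<lambda>i. replicate (t i) (of_dual (lam i))) [0..<l])"
  have Uc: "U \<in> carrier_mat N N" and UT: "ctranspose U \<in> carrier_mat N N"
    and UU: "U * ctranspose U = 1\<^sub>m N"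
    using U by (auto simp: unitary_def N_def)
  have P: "P \<in> carrier_mat N N"
    using Q(1) by (auto simp: P_def dc_adjoint_def Let_def N_def mult_2 four_block_carrier_mat)
  have blocks: "ctranspose U * P * U = mat_diag (length ys) (\<lambda>k. ys ! k)"
    using diag_block_mat_scalar_blocks[of "map (\<lambda>i. (of_dual (lam i) :: complex dual, t i)) [0..<l]"]
    by (simp add: P_def diag ys_def Let_def o_def)
  have len: "length ys = N"
    using arg_cong[OF blocks, of dim_row] UT by (simp add: mat_diag_def)
  have len_sum: "length ys = (\<Sum>k<l. t k)"
    by (simp add: ys_def length_concat o_def interv_sum_list_conv_sum_set_nat atLeast0LessThan)
  have PU: "P * U = U * mat_diag N (\<lambda>k. ys ! k)"
  proof -
    have "U * mat_diag N (\<lambda>k. ys ! k) = U * (ctranspose U * P * U)"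
      using blocks len by simp
    also have "\<dots> = (U * ctranspose U) * P * U"
      using Uc UT P by (simp add: assoc_mult_mat[where ?n\<^sub>1.0 = N and ?n\<^sub>2.0 = N and ?n\<^sub>3.0 = N and ?n\<^sub>4.0 = N]
          mult_carrier_mat[where n = N])
    also have "\<dots> = P * U" using P Uc by (simp add: UU)
    finally show ?thesis ..
  qed
  have col_eig: "P *\<^sub>v col U c = (ys ! c) \<cdot>\<^sub>v col U c" if c: "c < N" for c
  proof -
    have "P *\<^sub>v col U c = col (P * U) c"
      using P Uc c by (intro eq_vecI) auto
    also have "\<dots> = (ys ! c) \<cdot>\<^sub>v col U c"
      using Uc c by (intro eq_vecI) (auto simp: PU mat_diag_mult_right[OF Uc] mult.commute)
    finally show ?thesis .
  qed
  have v_eig: "dq_eigenvector Q (v i j) (lam i)" if "i < l" "j < t i" for i j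
  proof -
    define c where "c = (\<Sum>k<i. t k) + j"
    have "c < N" "ys ! c = of_dual (lam i)"
      using concat_replicate_nth(1)[of i l j t] that len len_sum
        concat_replicate_nth(2)[of i l j t "\<lambda>i. of_dual (lam i) :: complex dual"]
      by (simp_all add: c_def ys_def)
    then show ?thesis
      unfolding v[OF that] c_def[symmetric]
      using F_inv_column_eigenvector[OF Q(1) U] col_eig by (simp add: N_def P_def)
  qed
  have w_props: "\<And>x. x \<in> set (w i) \<Longrightarrow> dq_eigenvector Q x (lam i)" "distinct (w i)" "orthonormal (set (w i))"
    "\<And>j. j < t i \<Longrightarrow> v i j \<in> std_span n (set (w i))" if "i < l" for i
  proof -
    have "dq_eigenvector Q x (lam i)" if "x \<in> set (map (v i) [0..<t i])" for x
      using that v_eig[OF \<open>i < l\<close>] by auto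
    note ws = dq_orthogonalize_correct[OF Q(1), of "map (v i) [0..<t i]" "lam i", OF this]
    show "\<And>x. x \<in> set (w i) \<Longrightarrow> dq_eigenvector Q x (lam i)"
      unfolding w[OF \<open>i < l\<close>] by (rule ws(1))
    show "distinct (w i)" "orthonormal (set (w i))"
      unfolding w[OF \<open>i < l\<close>] using ws(2,3) by auto
    show "v i j \<in> std_span n (set (w i))" if "j < t i" for j
      unfolding w[OF \<open>i < l\<close>] using that by (intro subsetD[OF ws(4)]) auto
  qed
  define X where "X = (\<Union>i<l. set (w i))"
  \<comment> \<open>The index is in fact unique, but any choice gives an eigenvalue of \<open>x\<close>.\<close>
  define \<mu> where "\<mu> x = lam (SOME i. i < l \<and> x \<in> set (w i))" for x
  have \<mu>: "dq_eigenvector Q x (\<mu> x)" if "x \<in> X" for x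
  proof -
    have "\<exists>i. i < l \<and> x \<in> set (w i)" using that by (auto simp: X_def)
    from someI_ex[OF this] show ?thesis unfolding \<mu>_def using w_props(1) by blast
  qed
  have "std_part (cinner x y) = (if x = y then 1 else 0)" if xy: "x \<in> X" "y \<in> X" for x y
  proof -
    obtain i k where ik: "i < l" "x \<in> set (w i)" "k < l" "y \<in> set (w k)"
      using xy by (auto simp: X_def)
    show ?thesis
    proof (cases "i = k")
      case True
      then show ?thesis using w_props(3)[OF ik(1)] ik by (auto simp: orthonormal_def)
    next
      case False
      then have "lam i \<noteq> lam k" using lam_distinct ik by (auto simp: inj_on_def)
      then have 0: "std_part (cinner x y) = 0"
        using eigenvectors_std_orthogonal[OF Q w_props(1)[OF ik(1,2)] w_props(1)[OF ik(3,4)]] by blast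
      moreover have "cinner x x = 1"
        using w_props(3)[OF ik(1)] ik by (auto simp: orthonormal_def)
      ultimately have "x \<noteq> y" by auto
      with 0 show ?thesis by simp
    qed
  qed
  then have on: "std_orthonormal X" by (simp add: std_orthonormal_def)
  have fin: "finite X" by (simp add: X_def)
  have col_span: "F_inv n (col U c) \<in> std_span n X" if c: "c < 2 * n" for c
  proof -
    obtain i j where ij: "i < l" "j < t i" "c = (\<Sum>k<i. t k) + j"
      using block_index_surj[of c t l] c len len_sum by (auto simp: N_def)
    have "v i j \<in> std_span n (set (w i))" by (rule w_props(4)[OF ij(1,2)])
    then have "v i j \<in> std_span n X"
      using std_span_mono[OF _ fin, of "set (w i)"] ij(1) by (auto simp: X_def)
    then show ?thesis using v[OF ij(1,2)] ij(3) by simp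
  qed
  have "unit_vec n m \<in> std_span n X" if m: "m < n" for m
  proof (rule std_span_combination[where C = "{..<2 * n}" and y = "\<lambda>c. F_inv n (col U c)"])
    fix k assume "k < n"
    then show "std_part (unit_vec n m $ k) = (\<Sum>c<2 * n. std_part (F_inv n (col U c) $ k) *
        std_part (map_dual quat_of_complex (star (U $$ (m, c)))))"
      unfolding unit_vec_F_inv_combination[OF U m \<open>k < n\<close>] by (simp add: std_part_sum)
  qed (simp add: col_span)
  then have "complete_eigenvector_set Q X"
    using std_eigenbasis_complete[OF Q fin on, of \<mu>] \<mu> by blast
  moreover have "cinner (w i ! j) (w i ! k) = 0"
    if "i < l" "j < length (w i)" "k < length (w i)" "j \<noteq> k" for i j k
    using w_props(2,3)[OF that(1)] that by (simp add: orthonormal_def nth_eq_iff_index_eq)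
  ultimately show ?thesis
    using v_eig w_props(1) unfolding X_def by simp
qed

end
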